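(* Suppose there is a constant $c$ such that $\textsc{Greedy}(Q)\le c\cdot\mathrm{OPT}(Q)$ for every simple permutation $Q$. Then \textsc{RGreedy} is an $O(1)$-approximation algorithm for $\mathrm{OPT}$ on all permutations: there is a constant $C$ (depending only on $c$) such that for every permutation $X$ there is a block decomposition tree $\mathcal{T}$ of $X$ for which \textsc{RGreedy} run on $X$ with $\mathcal{T}$ produces a feasible output of size at most $C\cdot\mathrm{OPT}(X)$.
   Context: Geometric model: a permutation $X=(x_1,\dots,x_n)$ is the set of access points $\{(x_t,t)\}$. $\square_{pq}$: closed rectangle with corners $p,q$. $S$ is satisfied if for all $p,q\in S$ differing in both coordinates there is $r\in S\cap\square_{pq}\setminus\{p,q\}$. $\mathrm{OPT}(X)$ is the minimum size of a satisfied point set containing $X$. \textsc{Greedy} (no initial tree): let $\tau(b,t)$ be the largest time $\le t$ with an output point in column $b$; at time $t$ with access $(a,t)$, add $(a,t)$ and $(b,t)$ for each $b\ne a$ with $\tau(b,t-1)$ defined such that $\square_{(a,t),(b,\tau(b,t-1))}$ contains no output point at times $<t$ except $(b,\tau(b,t-1))$; $\textsc{Greedy}(Q)$ is its output size on $Q$. A permutation $\sigma\in S_\ell$ is simple if no interval $[a,b]$ of positions with $1<b-a+1<\ell$ has $\{\sigma_a,\dots,\sigma_b\}$ an interval of values. Blocks: time interval $[a,b]$ with $\{x_a,\dots,x_b\}=[c,d]$; region $[c,d]\times[a,b]$. Block decomposition tree: rooted tree of blocks, root $[n]\times[n]$, each node a leaf or with children $P_1,\dots,P_k$ ($k\ge2$),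 blocks whose time intervals partition the node's time interval consecutively, indexed in increasing time. Regions of a non-leaf node: $R(i,j)=I_i\times J_j$, with $I_1<\dots<I_k$ the children's key intervals left to right and $J_j$ the time interval of $P_j$. $\mathrm{topwing}(R)$ (w.r.t. current output): output points $q\in R$ topmost in their column within $R$ such that the rectangle between $q$ and (leftmost key, top time) of $R$, or between $q$ and (rightmost key, top time) of $R$, contains no other current output point, or $q$ in the leftmost/rightmost column of $R$. \textsc{RGreedy}: at time $t$ with access $(a,t)$, do the \textsc{Greedy} step; then with $v_1$ (leaf), $v_2=\mathrm{parent}(v_1),\dots,v_\ell$ the nodes whose blocks end at time $t$ and $v_{\ell+1}=\mathrm{parent}(v_\ell)$ if it exists, for $h=2,\dots,\ell+1$ in order, with children $P_1,\dots,P_k$ of $v_h$ and $(a,t)\in P_j$, for all $i$ add $(q.x,t)$ for every $q\in\mathrm{topwing}(R(i,j))$. *)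

theory Defs
  imports Complex_Main "HOL-Combinatorics.Permutations"
begin

text \<open>
  Points are pairs (key, time). A permutation of length \<open>n\<close> is a function \<open>X\<close> with
  \<open>X permutes {1..n}\<close>, where \<open>X t\<close> is the key accessed at time \<open>t\<close>.
\<close>

type_synonym point = "nat \<times> nat"

definition accesses :: "nat \<Rightarrow> (nat \<Rightarrow> nat) \<Rightarrow> point set" where
  "accesses n X = {(X t, t) | t. t \<in> {1..n}}"

definition rect :: "point \<Rightarrow> point \<Rightarrow> point set" where
  "rect p q = {min (fst p) (fst q)..max (fst p) (fst q)} \<times> {min (snd p) (snd q)..max (snd p) (snd q)}"

definition satisfied :: "point set \<Rightarrow> bool" where
  "satisfied S \<longleftrightarrow>
     (\<forall>p\<in>S. \<forall>q\<in>S. fst p \<noteq> fst q \<and> snd p \<noteq> snd q \<longrightarrow> (\<exists>r. r \<in> S \<inter> rect p q - {p, q}))"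

definition feasible :: "nat \<Rightarrow> (nat \<Rightarrow> nat) \<Rightarrow> point set \<Rightarrow> bool" where
  "feasible n X S \<longleftrightarrow> finite S \<and> accesses n X \<subseteq> S \<and> satisfied S"

definition OPT :: "nat \<Rightarrow> (nat \<Rightarrow> nat) \<Rightarrow> nat" where
  "OPT n X = (LEAST m. \<exists>S. feasible n X S \<and> card S = m)"

definition touched :: "point set \<Rightarrow> nat \<Rightarrow> nat \<Rightarrow> bool" where
  "touched S b t \<longleftrightarrow> (\<exists>s\<le>t. (b, s) \<in> S)"

text \<open>\<open>tau S b t\<close> is meaningful only if \<open>touched S b t\<close>.\<close>

definition tau :: "point set \<Rightarrow> nat \<Rightarrow> nat \<Rightarrow> nat" where
  "tau S b t = Max {s. s \<le> t \<and> (b, s) \<in> S}"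

definition greedy_step :: "(nat \<Rightarrow> nat) \<Rightarrow> nat \<Rightarrow> point set \<Rightarrow> point set" where
  "greedy_step X t S =
     S \<union> {(X t, t)} \<union>
     {(b, t) | b. b \<noteq> X t \<and> touched S b (t - 1) \<and>
        rect (X t, t) (b, tau S b (t - 1)) \<inter> {p \<in> S. snd p < t} \<subseteq> {(b, tau S b (t - 1))}}"

fun greedy :: "(nat \<Rightarrow> nat) \<Rightarrow> nat \<Rightarrow> point set" where
  "greedy X 0 = {}"
| "greedy X (Suc t) = greedy_step X (Suc t) (greedy X t)"

definition simple_perm :: "nat \<Rightarrow> (nat \<Rightarrow> nat) \<Rightarrow> bool" where
  "simple_perm l Q \<longleftrightarrow> Q permutes {1..l} \<and>
     \<not> (\<exists>a b. 1 \<le> a \<and> a \<le> b \<and> b \<le> l \<and> 1 < b - a + 1 \<and> b - a + 1 < l \<and>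
          (\<exists>c d. Q ` {a..b} = {c..d}))"

text \<open>
  A node of a block decomposition tree stores its time interval; its key interval is determined
  by the permutation. A leaf is a node without children and may be a block of any size.
\<close>

datatype btree = Node (start: nat) (stop: nat) (children: "btree list")

definition is_block :: "(nat \<Rightarrow> nat) \<Rightarrow> nat \<Rightarrow> nat \<Rightarrow> bool" where
  "is_block X a b \<longleftrightarrow> a \<le> b \<and> (\<exists>c d. X ` {a..b} = {c..d})"

definition time_span :: "btree \<Rightarrow> nat set" where
  "time_span v = {start v..stop v}"

definition key_span :: "(nat \<Rightarrow> nat) \<Rightarrow> btree \<Rightarrow> nat set" where
  "key_span X v = X ` time_span v"

inductive block_tree :: "(nat \<Rightarrow> nat) \<Rightarrow> btree \<Rightarrow> bool" for X where
  leaf: "is_block X a b \<Longrightarrow> block_tree X (Node a b [])"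
| inner: "is_block X a b \<Longrightarrow> 2 \<le> length cs \<Longrightarrow> (\<forall>c\<in>set cs. block_tree X c) \<Longrightarrow>
    start (hd cs) = a \<Longrightarrow> stop (last cs) = b \<Longrightarrow>
    (\<forall>i. Suc i < length cs \<longrightarrow> start (cs ! Suc i) = Suc (stop (cs ! i))) \<Longrightarrow>
    block_tree X (Node a b cs)"

definition block_decomposition_tree :: "nat \<Rightarrow> (nat \<Rightarrow> nat) \<Rightarrow> btree \<Rightarrow> bool" where
  "block_decomposition_tree n X T \<longleftrightarrow> block_tree X T \<and> start T = 1 \<and> stop T = n"

text \<open>Regions \<open>R(i,j)\<close> of a node; both indices are counted from 0.\<close>

definition region :: "(nat \<Rightarrow> nat) \<Rightarrow> btree \<Rightarrow> nat \<Rightarrow> nat \<Rightarrow> point set" where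
  "region X v i j =
     key_span X (sort_key (\<lambda>c. Min (key_span X c)) (children v) ! i) \<times> time_span (children v ! j)"

definition topwing :: "point set \<Rightarrow> point set \<Rightarrow> point set" where
  "topwing S R = {q \<in> S \<inter> R.
     (\<forall>r \<in> S \<inter> R. fst r = fst q \<longrightarrow> snd r \<le> snd q) \<and>
     (rect q (Min (fst ` R), Max (snd ` R)) \<inter> S \<subseteq> {q} \<or>
      rect q (Max (fst ` R), Max (snd ` R)) \<inter> S \<subseteq> {q} \<or>
      fst q = Min (fst ` R) \<or> fst q = Max (fst ` R))}"

text \<open>
  The nodes \<open>v\<^sub>2, \<dots>, v\<^sub>\<ell>\<^sub>+\<^sub>1\<close> that are treated at time \<open>t\<close>, from the bottom up: the parents of the
  nodes \<open>v\<^sub>1, \<dots>, v\<^sub>\<ell>\<close> whose blocks end at time \<open>t\<close>.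
  The list is empty if \<open>t\<close> is not the last time of a leaf.
\<close>

fun end_parents :: "nat \<Rightarrow> btree \<Rightarrow> btree list" where
  "end_parents t (Node a b cs) =
     concat (map (end_parents t) cs) @ (if \<exists>c\<in>set cs. stop c = t then [Node a b cs] else [])"

definition wing_step :: "(nat \<Rightarrow> nat) \<Rightarrow> nat \<Rightarrow> btree \<Rightarrow> point set \<Rightarrow> point set" where
  "wing_step X t v S = S \<union>
     {(fst q, t) | q i j. i < length (children v) \<and> j < length (children v) \<and>
        (X t, t) \<in> key_span X (children v ! j) \<times> time_span (children v ! j) \<and>
        q \<in> topwing S (region X v i j)}"

fun rgreedy :: "(nat \<Rightarrow> nat) \<Rightarrow> btree \<Rightarrow> nat \<Rightarrow> point set" where
  "rgreedy X T 0 = {}"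
| "rgreedy X T (Suc t) =
     fold (wing_step X (Suc t)) (end_parents (Suc t) T) (greedy_step X (Suc t) (rgreedy X T t))"

end

theory Submission imports Defs begin

text \<open>
  Take a block decomposition tree whose leaves are single accesses and whose inner nodes have simple
  quotients. At an inner node with children \<open>P\<^sub>1, \<dots>, P\<^sub>k\<close>, the wing steps keep the most recent point of
  every touched region in the last row of that region. Hence the regions that RGreedy touches are those
  that Greedy touches on the quotient. Once a block has ended, only its two extreme columns
  are touched again, so a region that is not a block receives at most four points in its first and last
  row; the rows in between contribute at most two points per time step over all levels together, because
  only the nearest nonempty column on either side of the current block stays visible. Thus the output
  has size \<open>O(n + \<Sum>\<^sub>v Greedy(Q\<^sub>v))\<close>.

  Conversely, contracting the regions of a node in an optimal solution gives a feasible solution for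
  its quotient, and the regions off the diagonals of different nodes are disjoint. Therefore
  \<open>\<Sum>\<^sub>v OPT(Q\<^sub>v) \<le> OPT(X) + \<Sum>\<^sub>v k\<^sub>v\<close>, where \<open>\<Sum>\<^sub>v k\<^sub>v \<le> 2n\<close>.
\<close>

text \<open>Feasibility is not inherited from Greedy: a wing step inserts points into row
  \<open>t\<close> without repairing the rectangles below them. It survives because an empty
  rectangle with upper corner at an inserted point \<open>(x, t)\<close> and lower corner
  \<open>(y, u)\<close> cannot occur. If \<open>y\<close> is a key of the node,
  \<open>(y, u)\<close> belongs to the wing of its own region, so \<open>(y, t)\<close> is inserted
  too; otherwise row \<open>u\<close> itself holds another point between the two columns. The second
  obstacle is that nested blocks may end together. A wing step of an ancestor can then put points
  into the last row of a node that Greedy on the quotient of this node does not account for. The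
  comparison with the quotient leaves out that one row, which is paid for by two points per child.
  Most arguments descend in a column from a point to its witness in an earlier row. A row no longer
  changes once its time is over, so both Greedy and wing points can be judged against the finished
  output.\<close>

lemma mem_rect:
  "(x, y) \<in> rect (a, b) (c, d) \<longleftrightarrow> min a c \<le> x \<and> x \<le> max a c \<and> min b d \<le> y \<and> y \<le> max b d"
  by (auto simp: rect_def)

section \<open>Block trees\<close>

fun nodes :: "btree \<Rightarrow> btree set" where
  "nodes (Node a b cs) = insert (Node a b cs) (\<Union>c\<in>set cs. nodes c)"

lemma nodes_unfold: "nodes v = insert v (\<Union>c\<in>set (children v). nodes c)"
  by (cases v) simp

lemma self_in_nodes [simp]: "v \<in> nodes v"
  by (subst nodes_unfold) simp

lemma finite_nodes [simp]: "finite (nodes v)"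
  by (induction v) auto

lemma nodes_child: "c \<in> set (children v) \<Longrightarrow> w \<in> nodes c \<Longrightarrow> w \<in> nodes v"
  by (subst nodes_unfold) auto

lemma nodes_trans: "v \<in> nodes w \<Longrightarrow> w \<in> nodes T \<Longrightarrow> v \<in> nodes T"
  by (induction T) auto

lemma child_in_nodes: "v \<in> nodes T \<Longrightarrow> c \<in> set (children v) \<Longrightarrow> c \<in> nodes T"
  using nodes_child nodes_trans self_in_nodes by blast

lemma nodes_proper_cases:
  assumes "w \<in> nodes v" "w \<noteq> v"
  obtains c where "c \<in> set (children v)" "w \<in> nodes c"
  using assms nodes_unfold[of v] by auto

lemma block_tree_child: "block_tree X v \<Longrightarrow> c \<in> set (children v) \<Longrightarrow> block_tree X c"
  by (erule block_tree.cases) auto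

lemma block_tree_nth_child:
  "block_tree X v \<Longrightarrow> i < length (children v) \<Longrightarrow> block_tree X (children v ! i)"
  using block_tree_child nth_mem by blast

lemma block_tree_node: "block_tree X T \<Longrightarrow> v \<in> nodes T \<Longrightarrow> block_tree X v"
proof (induction T)
  case (Node a b cs)
  then show ?case using block_tree_child[OF Node.prems(1)] by auto
qed

lemma block_tree_is_block: "block_tree X v \<Longrightarrow> is_block X (start v) (stop v)"
  by (erule block_tree.cases) auto

lemma block_tree_start_le_stop: "block_tree X v \<Longrightarrow> start v \<le> stop v"
  using block_tree_is_block is_block_def by blast

lemma block_tree_consecutive:
  "block_tree X v \<Longrightarrow> Suc i < length (children v) \<Longrightarrow>
     start (children v ! Suc i) = Suc (stop (children v ! i))"
  by (erule block_tree.cases) auto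

lemma block_tree_length:
  "block_tree X v \<Longrightarrow> children v \<noteq> [] \<Longrightarrow> 2 \<le> length (children v)"
  by (erule block_tree.cases) auto

lemma block_tree_start_hd:
  "block_tree X v \<Longrightarrow> children v \<noteq> [] \<Longrightarrow> start (children v ! 0) = start v"
  by (erule block_tree.cases) (auto simp: hd_conv_nth)

lemma block_tree_stop_last:
  "block_tree X v \<Longrightarrow> children v \<noteq> [] \<Longrightarrow> stop (children v ! (length (children v) - 1)) = stop v"
  by (erule block_tree.cases) (auto simp: last_conv_nth)

lemma children_before:
  assumes "block_tree X v" "i < j" "j < length (children v)"
  shows "stop (children v ! i) < start (children v ! j)"
  using assms(2,3)
proof (induction j)
  case (Suc j)
  have start: "start (children v ! Suc j) = Suc (stop (children v ! j))"
    using block_tree_consecutive[OF assms(1)] Suc.prems by simp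
  show ?case
  proof (cases "i = j")
    case False
    then have "stop (children v ! i) < start (children v ! j)"
      using Suc by simp
    moreover have "start (children v ! j) \<le> stop (children v ! j)"
      using block_tree_start_le_stop[OF block_tree_nth_child[OF assms(1)]] Suc.prems by simp
    ultimately show ?thesis using start by simp
  qed (use start in simp)
qed simp

lemma children_time_cover:
  assumes "block_tree X v" "children v \<noteq> []"
  shows "(\<Union>c\<in>set (children v). time_span c) = time_span v"
proof -
  let ?c = "\<lambda>i. children v ! i"
  have "(\<Union>i\<in>{..j}. time_span (?c i)) = {start v..stop (?c j)}" if "j < length (children v)" for j
    using that
  proof (induction j)
    case 0
    then show ?case using block_tree_start_hd[OF assms] by (simp add: time_span_def)
  next
    case (Suc j)
    have start: "start (?c (Suc j)) = Suc (stop (?c j))"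
      using block_tree_consecutive[OF assms(1)] Suc.prems by simp
    have *: "start (?c i) \<le> stop (?c i)" if "i < length (children v)" for i
      using block_tree_start_le_stop[OF block_tree_nth_child[OF assms(1)]] that by simp
    have "start v \<le> stop (?c j)"
    proof (cases "j = 0")
      case True
      then show ?thesis using *[of 0] assms block_tree_start_hd[OF assms] by simp
    next
      case False
      then show ?thesis
        using children_before[OF assms(1), of 0 j] *[of 0] *[of j] assms Suc.prems
          block_tree_start_hd[OF assms] by simp
    qed
    then show ?case
      using Suc start *[of "Suc j"] by (auto simp: atMost_Suc time_span_def)
  qed
  from this[of "length (children v) - 1"]
  have "(\<Union>i\<in>{..length (children v) - 1}. time_span (?c i)) = time_span v"
    using block_tree_stop_last[OF assms] assms(2) by (simp add: time_span_def)
  moreover have "set (children v) = ?c ` {..length (children v) - 1}"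
    using assms(2) by (auto simp: set_conv_nth)
      (metis Suc_pred atMost_iff image_eqI length_greater_0_conv less_Suc_eq_le)
  ultimately show ?thesis by simp
qed

lemma child_time_subset:
  assumes "block_tree X v" "c \<in> set (children v)"
  shows "time_span c \<subseteq> time_span v"
proof -
  have "children v \<noteq> []" using assms(2) by auto
  then show ?thesis using children_time_cover[OF assms(1)] assms(2) by auto
qed

lemma node_time_subset:
  assumes "block_tree X T" "v \<in> nodes T"
  shows "time_span v \<subseteq> time_span T"
  using assms
proof (induction T rule: btree.induct)
  case (Node a b cs)
  show ?case
  proof (cases "v = Node a b cs")
    case False
    then obtain c where c: "c \<in> set cs" "v \<in> nodes c" using Node.prems by auto
    then show ?thesis
      using Node.IH[OF c(1) block_tree_child[OF Node.prems(1)] c(2)]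
        child_time_subset[OF Node.prems(1), of c] by auto
  qed simp
qed

lemma children_eqI:
  assumes "block_tree X v" "c \<in> set (children v)" "d \<in> set (children v)"
    and "t \<in> time_span c" "t \<in> time_span d"
  shows "c = d"
proof -
  obtain i j where ij: "i < length (children v)" "j < length (children v)"
    "c = children v ! i" "d = children v ! j"
    using assms(2,3) by (metis in_set_conv_nth)
  have "i = j"
  proof (rule ccontr)
    assume "i \<noteq> j"
    then consider "i < j" | "j < i" by linarith
    then show False
      using children_before[OF assms(1)] ij assms(4,5) unfolding time_span_def
      by cases fastforce+
  qed
  then show ?thesis using ij by simp
qed

lemma start_in_time_span [simp]: "block_tree X v \<Longrightarrow> start v \<in> time_span v"
  and stop_in_time_span [simp]: "block_tree X v \<Longrightarrow> stop v \<in> time_span v"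
  using block_tree_start_le_stop by (auto simp: time_span_def)

lemma node_containing_child:
  assumes "block_tree X v" "w \<in> nodes v" "w \<noteq> v" "t \<in> time_span w"
    and "d \<in> set (children v)" "t \<in> time_span d"
  shows "w \<in> nodes d"
proof -
  obtain e where e: "e \<in> set (children v)" "w \<in> nodes e"
    using nodes_proper_cases assms(2,3) by blast
  have "t \<in> time_span e"
    using node_time_subset[OF block_tree_child[OF assms(1) e(1)] e(2)] assms(4) by auto
  then show ?thesis using children_eqI[OF assms(1) e(1) assms(5) _ assms(6)] e by simp
qed

lemma nodes_laminar:
  assumes "block_tree X T" "v \<in> nodes T" "w \<in> nodes T" "t \<in> time_span v" "t \<in> time_span w"
  shows "v \<in> nodes w \<or> w \<in> nodes v"
  using assms
proof (induction T rule: btree.induct)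
  case (Node a b cs)
  show ?case
  proof (cases "v = Node a b cs \<or> w = Node a b cs")
    case True
    then show ?thesis using Node.prems by blast
  next
    case False
    then obtain c where c: "c \<in> set cs" "v \<in> nodes c"
      using Node.prems by auto
    have bc: "block_tree X c" using block_tree_child[OF Node.prems(1)] c by simp
    have "t \<in> time_span c" using node_time_subset[OF bc c(2)] Node.prems by auto
    then have "w \<in> nodes c"
      using node_containing_child[OF Node.prems(1,3) _ Node.prems(5)] False c by simp
    then show ?thesis using Node.IH[OF c(1) bc c(2)] Node.prems by simp
  qed
qed

text \<open>For a point in row \<open>d\<close> this limits the wing steps that can have produced
  it: those of a node inside \<open>d\<close>, of \<open>v\<close> itself, or of a node one of whose
  rows contains all of \<open>v\<close>.\<close>

lemma node_position:
  assumes "block_tree X T" "v \<in> nodes T" "v' \<in> nodes T"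
    and "d \<in> set (children v)" "d' \<in> set (children v')" "t \<in> time_span d" "t \<in> time_span d'"
  shows "v' \<in> nodes d \<or> v' = v \<and> d' = d \<or> v \<in> nodes d'"
proof -
  have b: "block_tree X v" "block_tree X v'" using block_tree_node assms by auto
  have t: "t \<in> time_span v" "t \<in> time_span v'"
    using child_time_subset b assms(4-7) by blast+
  consider "v = v'" | "v \<noteq> v'" "v \<in> nodes v'" | "v \<noteq> v'" "v' \<in> nodes v"
    using nodes_laminar[OF assms(1-3) t] by blast
  then show ?thesis
  proof cases
    case 1
    then show ?thesis using children_eqI[OF b(1)] assms by blast
  next
    case 2
    then show ?thesis using node_containing_child[OF b(2)] t assms by blast
  next
    case 3
    then show ?thesis using node_containing_child[OF b(1)] t assms by metis
  qed
qed

lemma set_end_parents: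
  "set (end_parents t T) = {v \<in> nodes T. \<exists>c\<in>set (children v). stop c = t}"
  by (induction T) auto

section \<open>Key intervals of nodes\<close>

definition low_key :: "(nat \<Rightarrow> nat) \<Rightarrow> btree \<Rightarrow> nat" where
  "low_key X v = Min (key_span X v)"

definition high_key :: "(nat \<Rightarrow> nat) \<Rightarrow> btree \<Rightarrow> nat" where
  "high_key X v = Max (key_span X v)"

lemma key_span_eq:
  assumes "block_tree X v"
  shows "key_span X v = {low_key X v..high_key X v}" "low_key X v \<le> high_key X v"
proof -
  obtain c d where cd: "key_span X v = {c..d}"
    using block_tree_is_block[OF assms] by (auto simp: is_block_def key_span_def time_span_def)
  have "key_span X v \<noteq> {}"
    using block_tree_start_le_stop[OF assms] by (auto simp: key_span_def time_span_def)
  then have "c \<le> d" using cd by simp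
  then have "Min {c..d} = c" "Max {c..d} = d" by (auto intro: Min_eqI Max_eqI)
  then show "key_span X v = {low_key X v..high_key X v}" "low_key X v \<le> high_key X v"
    using cd \<open>c \<le> d\<close> by (auto simp: low_key_def high_key_def)
qed

lemma mem_key_span: "block_tree X v \<Longrightarrow> b \<in> key_span X v \<longleftrightarrow> low_key X v \<le> b \<and> b \<le> high_key X v"
  using key_span_eq by auto

lemma X_in_key_span: "t \<in> time_span v \<Longrightarrow> X t \<in> key_span X v"
  by (simp add: key_span_def)

lemma X_in_key_span_iff: "inj X \<Longrightarrow> X t \<in> key_span X v \<longleftrightarrow> t \<in> time_span v"
  by (auto simp: key_span_def dest: injD)

lemma node_key_subset:
  "block_tree X T \<Longrightarrow> v \<in> nodes T \<Longrightarrow> key_span X v \<subseteq> key_span X T"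
  unfolding key_span_def by (intro image_mono node_time_subset)

lemma child_key_subset:
  "block_tree X v \<Longrightarrow> c \<in> set (children v) \<Longrightarrow> key_span X c \<subseteq> key_span X v"
  unfolding key_span_def by (intro image_mono child_time_subset)

lemma children_key_cover:
  "block_tree X v \<Longrightarrow> children v \<noteq> [] \<Longrightarrow> (\<Union>c\<in>set (children v). key_span X c) = key_span X v"
  unfolding key_span_def by (simp add: children_time_cover flip: image_UN)

lemma children_key_eqI:
  assumes "block_tree X v" "inj X" "c \<in> set (children v)" "d \<in> set (children v)"
    and "b \<in> key_span X c" "b \<in> key_span X d"
  shows "c = d"
proof -
  obtain t where "b = X t" "t \<in> time_span c" using assms(5) by (auto simp: key_span_def)
  then show ?thesis using children_eqI[OF assms(1,3,4)] assms X_in_key_span_iff by blast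
qed

lemma topwing_product:
  assumes "block_tree X c" "block_tree X d"
  shows "topwing S (key_span X c \<times> time_span d) = {q \<in> S \<inter> (key_span X c \<times> time_span d).
     (\<forall>r \<in> S \<inter> (key_span X c \<times> time_span d). fst r = fst q \<longrightarrow> snd r \<le> snd q) \<and>
     (rect q (low_key X c, stop d) \<inter> S \<subseteq> {q} \<or> rect q (high_key X c, stop d) \<inter> S \<subseteq> {q} \<or>
      fst q = low_key X c \<or> fst q = high_key X c)}"
proof -
  have "key_span X c \<noteq> {}" "time_span d \<noteq> {}"
    using assms start_in_time_span X_in_key_span by blast+
  then have "fst ` (key_span X c \<times> time_span d) = key_span X c"
    "snd ` (key_span X c \<times> time_span d) = time_span d" by auto
  moreover have "Max (time_span d) = stop d"
    using block_tree_start_le_stop[OF assms(2)] by (auto simp: time_span_def intro: Max_eqI)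
  ultimately show ?thesis by (simp add: topwing_def low_key_def high_key_def)
qed

section \<open>Structure of the output\<close>

text \<open>For a point of the region the rectangles to the two upper corners extend upwards and to
  one side only, so \<open>min\<close> and \<open>max\<close> disappear.\<close>

lemma mem_topwing:
  assumes "block_tree X c" "block_tree X d"
  shows "(b, s) \<in> topwing S (key_span X c \<times> time_span d) \<longleftrightarrow>
    (b, s) \<in> S \<and> b \<in> key_span X c \<and> s \<in> time_span d \<and>
    (\<forall>s'\<in>time_span d. (b, s') \<in> S \<longrightarrow> s' \<le> s) \<and>
    ((\<forall>x y. (x, y) \<in> S \<and> low_key X c \<le> x \<and> x \<le> b \<and> s \<le> y \<and> y \<le> stop d \<longrightarrow> x = b \<and> y = s) \<or>
     (\<forall>x y. (x, y) \<in> S \<and> b \<le> x \<and> x \<le> high_key X c \<and> s \<le> y \<and> y \<le> stop d \<longrightarrow> x = b \<and> y = s) \<or>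
     b = low_key X c \<or> b = high_key X c)"
proof (cases "b \<in> key_span X c \<and> s \<in> time_span d")
  case True
  then have "low_key X c \<le> b" "b \<le> high_key X c" "s \<le> stop d"
    using mem_key_span[OF assms(1)] by (auto simp: time_span_def)
  then have left: "rect (b, s) (low_key X c, stop d) \<inter> S \<subseteq> {(b, s)} \<longleftrightarrow>
      (\<forall>x y. (x, y) \<in> S \<and> low_key X c \<le> x \<and> x \<le> b \<and> s \<le> y \<and> y \<le> stop d \<longrightarrow> x = b \<and> y = s)"
    and right: "rect (b, s) (high_key X c, stop d) \<inter> S \<subseteq> {(b, s)} \<longleftrightarrow>
      (\<forall>x y. (x, y) \<in> S \<and> b \<le> x \<and> x \<le> high_key X c \<and> s \<le> y \<and> y \<le> stop d \<longrightarrow> x = b \<and> y = s)"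
    by (auto simp: subset_iff mem_rect)
  have top: "(\<forall>r\<in>S \<inter> (key_span X c \<times> time_span d). fst r = b \<longrightarrow> snd r \<le> s) \<longleftrightarrow>
      (\<forall>s'\<in>time_span d. (b, s') \<in> S \<longrightarrow> s' \<le> s)"
    using True by force
  show ?thesis
    unfolding topwing_product[OF assms] mem_Collect_eq fst_conv snd_conv left right top
    using True by simp
next
  case False
  then show ?thesis unfolding topwing_product[OF assms] by auto
qed

text \<open>The witness \<open>s\<close> is forced to be the last touch of column \<open>b\<close>
  before \<open>t\<close>, because the condition also ranges over column \<open>b\<close> itself;
  this replaces \<open>tau\<close>. Only rows below \<open>t\<close> are inspected, so the predicate
  can be evaluated on the finished output.\<close>

definition greedy_touched :: "(nat \<Rightarrow> nat) \<Rightarrow> point set \<Rightarrow> nat \<Rightarrow> nat \<Rightarrow> bool" where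
  "greedy_touched X S b t \<longleftrightarrow> b = X t \<or>
     (\<exists>s<t. (b, s) \<in> S \<and> (\<forall>b' s'. (b', s') \<in> S \<and> s \<le> s' \<and> s' < t \<and>
        min (X t) b \<le> b' \<and> b' \<le> max (X t) b \<longrightarrow> b' = b \<and> s' = s))"

lemma greedy_touchedE:
  assumes "greedy_touched X S b t" "b \<noteq> X t"
  obtains s where "s < t" "(b, s) \<in> S"
    "\<And>b' s'. (b', s') \<in> S \<Longrightarrow> s \<le> s' \<Longrightarrow> s' < t \<Longrightarrow> min (X t) b \<le> b' \<Longrightarrow> b' \<le> max (X t) b \<Longrightarrow>
       b' = b \<and> s' = s"
  using assms unfolding greedy_touched_def by blast

text \<open>
  \<open>F\<close> is the final output and \<open>W t v S\<close> says that \<open>S\<close> is the point set just before the wing step of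
  node \<open>v\<close> at time \<open>t\<close>. Regions are indexed by pairs of children, which avoids the sorted order.
\<close>

locale rgreedy_output =
  fixes X :: "nat \<Rightarrow> nat" and n :: nat and T :: btree and F :: "point set"
    and W :: "nat \<Rightarrow> btree \<Rightarrow> point set \<Rightarrow> bool"
  assumes permutes: "X permutes {1..n}"
    and tree: "block_tree X T"
    and span_T: "time_span T = {1..n}"
    and greedyI: "1 \<le> t \<Longrightarrow> t \<le> n \<Longrightarrow> greedy_touched X F b t \<Longrightarrow> (b, t) \<in> F"
    and F_cases: "(b, t) \<in> F \<Longrightarrow> 1 \<le> t \<and> t \<le> n \<and> (greedy_touched X F b t \<or>
      (\<exists>v\<in>nodes T. \<exists>c\<in>set (children v). \<exists>d\<in>set (children v). stop d = t \<and>
        (\<exists>S s. W t v S \<and> s < t \<and> (b, s) \<in> topwing S (key_span X c \<times> time_span d))))"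
    and W_lower: "W t v S \<Longrightarrow> (b, s) \<in> F \<Longrightarrow> s < t \<Longrightarrow> (b, s) \<in> S"
    and W_upper: "W t v S \<Longrightarrow> (b, s) \<in> S \<Longrightarrow> (b, s) \<in> F \<and> s \<le> t"
    and W_touch: "W t v S \<Longrightarrow> v \<in> nodes T \<Longrightarrow> c \<in> set (children v) \<Longrightarrow> d \<in> set (children v) \<Longrightarrow>
      stop d = t \<Longrightarrow> (b, s) \<in> topwing S (key_span X c \<times> time_span d) \<Longrightarrow> (b, t) \<in> F"
    and W_ex: "v \<in> nodes T \<Longrightarrow> d \<in> set (children v) \<Longrightarrow> stop d = t \<Longrightarrow> \<exists>S. W t v S"
begin

abbreviation "K \<equiv> key_span X"
abbreviation "J \<equiv> time_span"
abbreviation "lo \<equiv> low_key X"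
abbreviation "hi \<equiv> high_key X"
abbreviation "gt \<equiv> greedy_touched X F"

lemma inj_X: "inj X"
  using permutes permutes_inj by blast

lemma bt: "v \<in> nodes T \<Longrightarrow> block_tree X v"
  using block_tree_node[OF tree] .

lemma btc: "v \<in> nodes T \<Longrightarrow> c \<in> set (children v) \<Longrightarrow> block_tree X c"
  using bt block_tree_child by blast

lemma K_T: "K T = {1..n}"
  using span_T permutes by (simp add: key_span_def permutes_image)

lemma span_bounds: "v \<in> nodes T \<Longrightarrow> t \<in> J v \<Longrightarrow> 1 \<le> t \<and> t \<le> n"
  using node_time_subset[OF tree] span_T by fastforce

lemma access_in_F: "1 \<le> t \<Longrightarrow> t \<le> n \<Longrightarrow> (X t, t) \<in> F"
  by (rule greedyI) (auto simp: greedy_touched_def)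

lemma wing_casesE:
  assumes "(b, t) \<in> F" "\<not> gt b t"
  obtains v c d S s where "v \<in> nodes T" "c \<in> set (children v)" "d \<in> set (children v)" "stop d = t"
    "W t v S" "s < t" "(b, s) \<in> topwing S (K c \<times> J d)" "(b, s) \<in> F" "b \<in> K c" "s \<in> J d" "t \<in> J d"
proof -
  obtain v c d S s where *: "v \<in> nodes T" "c \<in> set (children v)" "d \<in> set (children v)" "stop d = t"
    "W t v S" "s < t" "(b, s) \<in> topwing S (K c \<times> J d)"
    using F_cases[OF assms(1)] assms(2) by blast
  then have "(b, s) \<in> S" "b \<in> K c" "s \<in> J d"
    using mem_topwing[OF btc[OF *(1,2)] btc[OF *(1,3)]] by auto
  moreover have "t \<in> J d" using * btc stop_in_time_span by metis
  ultimately show ?thesis using that[OF *] W_upper[OF *(5)] by blast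
qed

text \<open>Greedy points other than the access and wing points both rest on an earlier point of the
  same column. With no initial tree, the descent can only end at an access.\<close>

lemma access_time:
  assumes "(b, s) \<in> F"
  shows "\<exists>r. 1 \<le> r \<and> r \<le> s \<and> X r = b"
  using assms
proof (induction s rule: less_induct)
  case (less t)
  have "1 \<le> t" using F_cases[OF less.prems] by simp
  have *: ?case if "s < t" "(b, s) \<in> F" for s
    using less.IH[OF that] that(1) order.trans[OF _ less_imp_le] by blast
  show ?case
  proof (cases "gt b t")
    case True
    then show ?thesis
      using * \<open>1 \<le> t\<close> unfolding greedy_touched_def by blast
  next
    case False
    then obtain s where "s < t" "(b, s) \<in> F"
      by (rule wing_casesE[OF less.prems]) blast
    then show ?thesis using * by blast
  qed
qed

text \<open>A key of \<open>w\<close> is accessed only during \<open>w\<close>, and no column is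
  used before its access.\<close>

lemma key_time_start:
  assumes "b \<in> K w" "(b, s) \<in> F"
  shows "start w \<le> s"
proof -
  obtain r where r: "r \<le> s" "X r = b" using access_time[OF assms(2)] by blast
  then have "r \<in> J w" using assms(1) X_in_key_span_iff[OF inj_X] by blast
  then show ?thesis using r by (simp add: time_span_def)
qed

lemma F_bounds: "F \<subseteq> {1..n} \<times> {1..n}"
proof
  fix p assume p: "p \<in> F"
  obtain b t where bt: "p = (b, t)" by force
  obtain r where r: "1 \<le> r" "r \<le> t" "X r = b" using access_time p bt by blast
  have t: "1 \<le> t" "t \<le> n" using F_cases p bt by auto
  then have "X r \<in> {1..n}"
    using permutes_in_image[OF permutes, of r] r by simp
  then show "p \<in> {1..n} \<times> {1..n}" using bt r t by auto
qed

lemma finite_F: "finite F"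
  using F_bounds finite_subset by blast

text \<open>A wing step at \<open>t\<close> belongs to a node inside \<open>w\<close>, and then adds
  only keys of \<open>w\<close>, or to a node with a child containing \<open>w\<close>; that child
  would end at \<open>t\<close>, before \<open>w\<close> does.\<close>

lemma outside_greedy:
  assumes "(b, t) \<in> F" "w \<in> nodes T" "t \<in> J w" "t < stop w" "b \<notin> K w"
  shows "gt b t"
proof (rule ccontr)
  assume "\<not> gt b t"
  then obtain v c d s where *: "v \<in> nodes T" "c \<in> set (children v)" "d \<in> set (children v)"
      "stop d = t" "b \<in> K c" "t \<in> J d"
    by (rule wing_casesE[OF assms(1)]) blast
  have tv: "t \<in> J v" using child_time_subset[OF bt[OF *(1)] *(3)] * by blast
  show False
  proof (cases "v \<in> nodes w")
    case True
    have "b \<in> K v" using child_key_subset[OF bt[OF *(1)] *(2)] * by blast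
    then show False using node_key_subset[OF bt[OF assms(2)] True] assms by blast
  next
    case False
    then have "w \<in> nodes v" "w \<noteq> v"
      using nodes_laminar[OF tree *(1) assms(2) tv assms(3)] by auto
    then have "w \<in> nodes d"
      using node_containing_child[OF bt[OF *(1)] _ _ assms(3)] * by blast
    then have "J w \<subseteq> J d" using node_time_subset btc * by blast
    moreover have "stop w \<in> J w" using bt[OF assms(2)] by simp
    ultimately show False using assms * by (auto simp: time_span_def)
  qed
qed

section \<open>Columns outside a block while it runs\<close>

lemma outside_touched_before:
  assumes "gt b u" "w \<in> nodes T" "u \<in> J w" "b \<notin> K w"
  shows "\<exists>s<start w. (b, s) \<in> F"
  using assms(1,3)
proof (induction u rule: less_induct)
  case (less u)
  have "b \<noteq> X u" using assms less.prems X_in_key_span by metis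
  then obtain s where s: "s < u" "(b, s) \<in> F"
    by (rule greedy_touchedE[OF less.prems(1)]) blast
  show ?case
  proof (cases "s < start w")
    case True
    then show ?thesis using s by blast
  next
    case False
    then have "s \<in> J w" "s < stop w" using s less.prems by (auto simp: time_span_def)
    moreover have "gt b s" using outside_greedy s assms calculation by blast
    ultimately show ?thesis using less.IH s by blast
  qed
qed

text \<open>The keys of \<open>w\<close> form an interval, so all of them lie on the same side of a
  column outside it, and accesses within \<open>w\<close> can be exchanged.\<close>

lemma between_transfer:
  assumes "w \<in> nodes T" "x \<in> K w" "x' \<in> K w" "b \<notin> K w" "min x c \<le> b" "b \<le> max x c"
  shows "min x' c \<le> b" "b \<le> max x' c"
  using assms mem_key_span[OF bt[OF assms(1)]] by (auto simp: min_def max_def split: if_splits)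

text \<open>Among the columns used before \<open>w\<close> and lying from \<open>x\<close> towards
  \<open>c\<close>, the one nearest to \<open>x\<close> works: the columns of \<open>w\<close> are
  still empty, so nothing hides its last point from the first access in \<open>w\<close>.\<close>

lemma closest_touched_at_start:
  assumes "w \<in> nodes T" "x \<in> K w" "c \<notin> K w" "s0 < start w" "(c, s0) \<in> F"
  obtains c' where "c' \<notin> K w" "min x c \<le> c'" "c' \<le> max x c" "gt c' (start w)"
proof -
  define P where "P c' \<longleftrightarrow> c' \<notin> K w \<and> min x c \<le> c' \<and> c' \<le> max x c \<and> (\<exists>s<start w. (c', s) \<in> F)" for c'
  define D where "D c' = nat \<bar>int x - int c'\<bar>" for c'
  have "P c" using assms by (auto simp: P_def)
  then obtain c' where c': "P c'" "\<And>c''. P c'' \<Longrightarrow> D c' \<le> D c''"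
    using ex_has_least_nat[of P c D] by blast
  define A where "A = {s. s < start w \<and> (c', s) \<in> F}"
  have A: "finite A" "A \<noteq> {}" using c'(1) by (auto simp: A_def P_def)
  define s where "s = Max A"
  have s: "s < start w" "(c', s) \<in> F" using Max_in[OF A] by (auto simp: A_def s_def)
  have max: "s' \<le> s" if "s' < start w" "(c', s') \<in> F" for s'
    using A that by (auto simp: s_def A_def)
  have XK: "X (start w) \<in> K w" using bt[OF assms(1)] X_in_key_span by simp
  have "gt c' (start w)"
    unfolding greedy_touched_def
  proof (intro disjI2 exI[of _ s] conjI s allI impI)
    fix b' s'
    assume *: "(b', s') \<in> F \<and> s \<le> s' \<and> s' < start w \<and> min (X (start w)) c' \<le> b' \<and> b' \<le> max (X (start w)) c'"
    have "b' \<notin> K w" using key_time_start * by (metis leD)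
    then have b: "min x c' \<le> b'" "b' \<le> max x c'"
      using between_transfer[OF assms(1) XK assms(2)] * by blast+
    then have "min x c \<le> b'" "b' \<le> max x c"
      using c'(1) unfolding P_def min_def max_def by (auto split: if_splits)
    then have "P b'" using * \<open>b' \<notin> K w\<close> by (auto simp: P_def)
    then have "D c' \<le> D b'" using c' by blast
    then have "b' = c'" using b by (auto simp: D_def min_def max_def split: if_splits)
    then show "b' = c'" "s' = s" using max[of s'] * by auto
  qed
  then show ?thesis using that c'(1) by (auto simp: P_def)
qed

text \<open>
  At the start of a block \<open>w\<close> the stair leaving its key interval touches the nearest nonempty column
  \<open>c\<close> on each side; from then on \<open>c\<close> is as recent as everything behind it and hides it from the
  accesses in \<open>w\<close>.
\<close>

lemma not_beyond_touched:
  assumes "w \<in> nodes T" "x \<in> K w" "c \<notin> K w" "gt c (start w)"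
    and "min x b \<le> c" "c \<le> max x b" "b \<noteq> c" "u \<in> J w" "start w < u"
  shows "\<not> gt b u"
  using assms(8,9)
proof (induction u rule: less_induct)
  case (less u)
  have Xu: "X u \<in> K w" using X_in_key_span less.prems by simp
  have "b \<notin> K w"
    using assms(1-7) mem_key_span[OF bt[OF assms(1)]] by (auto simp: min_def max_def split: if_splits)
  have c: "min (X u) b \<le> c" "c \<le> max (X u) b"
    using between_transfer[OF assms(1,2) Xu assms(3,5,6)] .
  have cF: "(c, start w) \<in> F"
    using greedyI[OF _ _ assms(4)] span_bounds[OF assms(1)] bt[OF assms(1)] by simp
  show ?case
  proof
    assume "gt b u"
    moreover have "b \<noteq> X u" using Xu \<open>b \<notin> K w\<close> by blast
    ultimately obtain s where s: "s < u" "(b, s) \<in> F"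
      "\<And>b' s'. (b', s') \<in> F \<Longrightarrow> s \<le> s' \<Longrightarrow> s' < u \<Longrightarrow> min (X u) b \<le> b' \<Longrightarrow> b' \<le> max (X u) b \<Longrightarrow>
         b' = b \<and> s' = s"
      by (rule greedy_touchedE) blast
    \<comment> \<open>The point of \<open>c\<close> in the first row of \<open>w\<close> lies
      between the access and column \<open>b\<close>, so the witness of \<open>b\<close> must be
      later than that row. It is again a Greedy point of column \<open>b\<close>, and the descent
      would never end.\<close>
    have "start w < s"
      using s(3)[OF cF _ less.prems(2) c] assms(7) by force
    then have "s \<in> J w" "s < stop w" using s(1) less.prems by (auto simp: time_span_def)
    moreover from this have "gt b s" using outside_greedy[OF s(2) assms(1)] \<open>b \<notin> K w\<close> by blast
    ultimately show False using less.IH s(1) \<open>start w < s\<close> by blast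
  qed
qed

text \<open>The column was used before \<open>w\<close>. Some used column from the access up to it
  is touched at \<open>start w\<close> and would hide everything behind it, so it is the column
  itself.\<close>

lemma outside_gt_start:
  assumes "w \<in> nodes T" "u \<in> J w" "b \<notin> K w" "gt b u"
  shows "gt b (start w)"
proof (cases "u = start w")
  case False
  then have "start w < u" using assms by (auto simp: time_span_def)
  have Xu: "X u \<in> K w" using X_in_key_span assms by simp
  obtain s where "s < start w" "(b, s) \<in> F" using outside_touched_before assms by blast
  then obtain c where c: "c \<notin> K w" "min (X u) b \<le> c" "c \<le> max (X u) b" "gt c (start w)"
    using closest_touched_at_start[OF assms(1) Xu assms(3)] by blast
  then have "c = b"
    using not_beyond_touched[OF assms(1) Xu c(1,4,2,3) _ assms(2) \<open>start w < u\<close>] assms by blast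
  then show ?thesis using c by simp
qed (use assms in simp)

text \<open>This bounds the points strictly inside a row: behind a visible column nothing else is
  visible.\<close>

lemma one_beyond_per_side:
  assumes "w \<in> nodes T" "u \<in> J w" "start w < u" "gt c u" "gt b u" "c \<notin> K w"
    and "min (X u) b \<le> c" "c \<le> max (X u) b"
  shows "b = c"
  using not_beyond_touched[OF assms(1) X_in_key_span[OF assms(2)] assms(6) _ assms(7,8) _ assms(2,3)]
    outside_gt_start[OF assms(1,2,6,4)] assms(5) by blast

end

section \<open>Effect of the wing steps on regions and columns\<close>

context rgreedy_output
begin

text \<open>The topmost point of an extreme column belongs to the wing without any condition on
  rectangles, so it is copied up when the row ends.\<close>

lemma extreme_column_at_stop:
  assumes "v \<in> nodes T" "c \<in> set (children v)" "d \<in> set (children v)"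
    and "(z, r) \<in> F" "r \<in> J d" "z = lo c \<or> z = hi c"
  shows "(z, stop d) \<in> F"
proof (cases "r = stop d")
  case False
  obtain S where S: "W (stop d) v S" using W_ex assms by blast
  define A where "A = {s \<in> J d. (z, s) \<in> S}"
  have "r \<in> A" using W_lower[OF S assms(4)] False assms(5) by (auto simp: A_def time_span_def)
  then have A: "finite A" "A \<noteq> {}" by (auto simp: A_def time_span_def)
  have "z \<in> K c" using assms(6) key_span_eq[OF btc[OF assms(1,2)]] by auto
  then have "(z, Max A) \<in> topwing S (K c \<times> J d)"
    using Max_in[OF A] Max_ge[OF A(1)] assms(6)
    unfolding mem_topwing[OF btc[OF assms(1,2)] btc[OF assms(1,3)]] A_def by auto
  then show ?thesis using W_touch[OF S assms(1-3)] by simp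
qed (use assms in simp)

text \<open>In the last occupied row of the region, the leftmost point has an empty rectangle
  towards the upper left corner. It is therefore a wing point, and its column is copied to the end
  of the row.\<close>

lemma region_touched_at_stop:
  assumes "v \<in> nodes T" "c \<in> set (children v)" "d \<in> set (children v)"
    and "(b, r) \<in> F" "r \<in> J d" "b \<in> K c"
  shows "\<exists>b'\<in>K c. (b', stop d) \<in> F"
proof -
  have bc: "block_tree X c" and bd: "block_tree X d" using btc assms(1-3) by auto
  define A where "A = {r \<in> J d. \<exists>b\<in>K c. (b, r) \<in> F}"
  have A: "finite A" "A \<noteq> {}" using assms by (auto simp: A_def time_span_def)
  define r0 where "r0 = Max A"
  have r0: "r0 \<in> A" and maxA: "\<And>r. r \<in> A \<Longrightarrow> r \<le> r0" using Max_in[OF A] Max_ge[OF A(1)] by (auto simp: r0_def)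
  define B where "B = {b \<in> K c. (b, r0) \<in> F}"
  have B: "finite B" "B \<noteq> {}" using r0 by (auto simp: B_def A_def key_span_eq[OF bc])
  define b0 where "b0 = Min B"
  have b0: "b0 \<in> B" and minB: "\<And>b. b \<in> B \<Longrightarrow> b0 \<le> b" using Min_in[OF B] Min_le[OF B(1)] by (auto simp: b0_def)
  show ?thesis
  proof (cases "r0 = stop d")
    case True
    then show ?thesis using r0 by (auto simp: A_def)
  next
    case False
    then have "r0 < stop d" using r0 by (auto simp: A_def time_span_def)
    obtain S where S: "W (stop d) v S" using W_ex assms by blast
    have "(b0, r0) \<in> topwing S (K c \<times> J d)"
      unfolding mem_topwing[OF bc bd]
    proof (intro conjI ballI impI disjI1 allI)
      show "(b0, r0) \<in> S" using W_lower[OF S] b0 \<open>r0 < stop d\<close> by (auto simp: B_def)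
      show "b0 \<in> K c" "r0 \<in> J d" using b0 r0 by (auto simp: B_def A_def)
      show "s' \<le> r0" if "s' \<in> J d" "(b0, s') \<in> S" for s'
        using maxA[of s'] that W_upper[OF S] b0 by (auto simp: A_def B_def)
      fix x y
      assume xy: "(x, y) \<in> S \<and> lo c \<le> x \<and> x \<le> b0 \<and> r0 \<le> y \<and> y \<le> stop d"
      then have "x \<in> K c" "y \<in> J d" "(x, y) \<in> F"
        using W_upper[OF S] b0 r0 mem_key_span[OF bc] by (auto simp: B_def A_def time_span_def)
      then have "y \<in> A" by (auto simp: A_def)
      then show "y = r0" using maxA[of y] xy by simp
      then show "x = b0" using minB[of x] xy \<open>x \<in> K c\<close> \<open>(x, y) \<in> F\<close> by (auto simp: B_def)
    qed
    then have "(b0, stop d) \<in> F" using W_touch[OF S assms(1-3)] by simp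
    then show ?thesis using b0 by (auto simp: B_def)
  qed
qed

text \<open>Every key of a block is accessed within it, so its diagonal region has points in both
  extreme columns.\<close>

lemma corners_at_stop:
  assumes "v \<in> nodes T" "w \<in> set (children v)" "z = lo w \<or> z = hi w"
  shows "(z, stop w) \<in> F"
proof -
  have "z \<in> K w" using assms key_span_eq[OF btc[OF assms(1,2)]] by auto
  then obtain r where r: "z = X r" "r \<in> J w" by (auto simp: key_span_def)
  then have "(z, r) \<in> F"
    using access_in_F span_bounds[OF child_in_nodes[OF assms(1,2)]] by blast
  then show ?thesis using extreme_column_at_stop[OF assms(1,2,2)] r assms by blast
qed

text \<open>
  The extreme columns of a block are touched when it ends, and every later access comes from outside,
  so they shield all columns between them.
\<close>

lemma inner_columns_untouched_after:
  assumes "v \<in> nodes T" "w \<in> set (children v)" "(b, u) \<in> F" "stop w < u"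
  shows "b \<le> lo w \<or> hi w \<le> b"
  using assms(3,4)
proof (induction u rule: less_induct)
  case (less u)
  have w: "w \<in> nodes T" and bw: "block_tree X w" using child_in_nodes btc assms(1,2) by auto
  have corners: "(lo w, stop w) \<in> F" "(hi w, stop w) \<in> F" using corners_at_stop assms by auto
  show ?case
  proof (rule ccontr)
    assume "\<not> ?case"
    then have inner: "lo w < b" "b < hi w" by auto
    then have bK: "b \<in> K w" using mem_key_span[OF bw] by simp
    have before: "s \<le> stop w" if "(b, s) \<in> F" "s < u" for s
      using less.IH[OF that(2,1)] inner by linarith
    have "u \<notin> J w" using less.prems by (auto simp: time_span_def)
    then have Xu: "X u \<notin> K w" using X_in_key_span_iff[OF inj_X] by blast
    show False
    proof (cases "gt b u")
      case True
      have "b \<noteq> X u" using Xu bK by blast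
      from True this obtain s where s: "s < u" "(b, s) \<in> F"
        "\<And>b' s'. (b', s') \<in> F \<Longrightarrow> s \<le> s' \<Longrightarrow> s' < u \<Longrightarrow> min (X u) b \<le> b' \<Longrightarrow> b' \<le> max (X u) b \<Longrightarrow>
           b' = b \<and> s' = s"
        by (rule greedy_touchedE) blast
      have "s \<le> stop w" using before[OF s(2,1)] .
      consider "X u < lo w" | "hi w < X u" using Xu by (auto simp: mem_key_span[OF bw])
      then show False
      proof cases
        case 1
        then show False
          using s(3)[OF corners(1) \<open>s \<le> stop w\<close> less.prems(2)] inner by simp
      next
        case 2
        then show False
          using s(3)[OF corners(2) \<open>s \<le> stop w\<close> less.prems(2)] inner by simp
      qed
    next
      case False
      then obtain v' c d S s where *: "v' \<in> nodes T" "c \<in> set (children v')" "d \<in> set (children v')"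
        "stop d = u" "W u v' S" "s < u" "(b, s) \<in> topwing S (K c \<times> J d)" "(b, s) \<in> F"
        "b \<in> K c" "s \<in> J d"
        by (rule wing_casesE[OF less.prems(1)]) blast
      \<comment> \<open>The row \<open>d\<close> contains \<open>stop w\<close> and ends after
        \<open>w\<close>, hence contains all of \<open>w\<close>. As \<open>b\<close> is a key of
        \<open>d\<close>, the region is the diagonal one. Both rectangles of \<open>(b, s)\<close>
        then contain a corner of \<open>w\<close>, and \<open>b\<close> is not an extreme key of
        \<open>d\<close>.\<close>
      have s: "s \<le> stop w" using before * by blast
      then have "stop w \<in> J d" using *(4,10) less.prems by (auto simp: time_span_def)
      moreover have d: "d \<in> nodes T" using child_in_nodes * by blast
      moreover have "\<not> d \<in> nodes w"
        using node_time_subset[OF bw, of d] stop_in_time_span[OF bt[OF d]] \<open>u \<notin> J w\<close> *(4) by auto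
      ultimately have "w \<in> nodes d"
        using nodes_laminar[OF tree d w _ stop_in_time_span[OF bw]] by blast
      then have Kw: "K w \<subseteq> K d" using node_key_subset bt d by blast
      then have "c = d" using children_key_eqI[OF bt[OF *(1)] inj_X *(2,3,9)] bK by blast
      have bd: "block_tree X d" using bt d .
      have lohi: "lo d \<le> lo w" "hi w \<le> hi d"
        using Kw mem_key_span[OF bd] key_span_eq[OF bw] by auto
      have S: "(lo w, stop w) \<in> S" "(hi w, stop w) \<in> S"
        using W_lower[OF *(5)] corners less.prems by auto
      show False
        using *(7) S s lohi inner less.prems(2) *(4)
        unfolding \<open>c = d\<close> mem_topwing[OF bd bd] by fastforce
    qed
  qed
qed

text \<open>The columns of \<open>c\<close> are empty before \<open>c\<close> starts, so a point of
  such a region comes after the end of \<open>c\<close>, when only extreme columns can still be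
  used.\<close>

lemma nonblock_region_columns:
  assumes "v \<in> nodes T" "c \<in> set (children v)" "d \<in> set (children v)" "c \<noteq> d"
    and "(b, t) \<in> F" "b \<in> K c" "t \<in> J d"
  shows "b = lo c \<or> b = hi c"
proof -
  have "t \<notin> J c" using children_eqI[OF bt[OF assms(1)] assms(2,3)] assms(4,7) by blast
  then have "stop c < t" using key_time_start[OF assms(6,5)] by (auto simp: time_span_def)
  then show ?thesis
    using inner_columns_untouched_after[OF assms(1,2,5)] mem_key_span[OF btc[OF assms(1,2)]] assms(6)
    by force
qed

text \<open>Off the diagonal, follow the column down inside row \<open>d\<close>. Wing steps inside
  \<open>d\<close> use only keys of \<open>d\<close>, those of \<open>v\<close> lead to an earlier
  point of the row, and those of ancestors come no earlier than \<open>stop v\<close>, whence the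
  last hypothesis. A Greedy point was already visible at the start of the row.\<close>

lemma region_touched_at_start:
  assumes "v \<in> nodes T" "c \<in> set (children v)" "d \<in> set (children v)"
    and "(b, t) \<in> F" "b \<in> K c" "t \<in> J d" "t \<noteq> stop v"
  shows "\<exists>b'\<in>K c. gt b' (start d)"
proof (cases "c = d")
  case True
  then have "X (start d) \<in> K c" using X_in_key_span start_in_time_span btc[OF assms(1,3)] by blast
  moreover have "gt (X (start d)) (start d)" by (simp add: greedy_touched_def)
  ultimately show ?thesis by blast
next
  case False
  have d: "d \<in> nodes T" using child_in_nodes assms by blast
  have bd: "b \<notin> K d" using children_key_eqI[OF bt[OF assms(1)] inj_X assms(2,3)] False assms(5) by blast
  have vJ: "u \<le> stop v" if "u \<in> J d" for u
    using child_time_subset[OF bt[OF assms(1)] assms(3)] that by (auto simp: time_span_def)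
  have "gt b (start d)" using assms(4,6,7)
  proof (induction t rule: less_induct)
    case (less t)
    show ?case
    proof (cases "gt b t")
      case True
      then show ?thesis using outside_gt_start[OF d less.prems(2) bd] by blast
    next
      case False
      then obtain v' c' d' s where *: "v' \<in> nodes T" "c' \<in> set (children v')" "d' \<in> set (children v')"
        "stop d' = t" "s < t" "(b, s) \<in> F" "b \<in> K c'" "s \<in> J d'" "t \<in> J d'"
        by (rule wing_casesE[OF less.prems(1)]) blast
      consider "v' \<in> nodes d" | "v' = v" "d' = d" | "v \<in> nodes d'"
        using node_position[OF tree assms(1) *(1) assms(3) *(3) less.prems(2) *(9)] by blast
      then show ?thesis
      proof cases
        case 1
        then have "b \<in> K d"
          using node_key_subset[OF bt[OF d]] child_key_subset[OF bt[OF *(1)] *(2)] *(7) by blast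
        then show ?thesis using bd by simp
      next
        case 2
        then show ?thesis using less.IH[OF *(5,6)] *(5,8) vJ[OF less.prems(2)] by simp
      next
        case 3
        then have "stop v \<in> J d'"
          using node_time_subset[OF btc[OF *(1,3)]] stop_in_time_span[OF bt[OF assms(1)]] by blast
        then show ?thesis using *(4) vJ[OF less.prems(2)] less.prems(3) by (auto simp: time_span_def)
      qed
    qed
  qed
  then show ?thesis using assms(5) by blast
qed

section \<open>Feasibility of the output\<close>

lemma row_point_between:
  assumes "v \<in> nodes T" "d \<in> set (children v)" "(x, s) \<in> F" "x \<in> K v" "s \<in> J d"
    and top: "\<And>s'. s < s' \<Longrightarrow> s' < stop d \<Longrightarrow> (x, s') \<notin> F"
    and "y \<notin> K v" "(y, u) \<in> F" "s < u" "u < stop d"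
  shows "\<exists>z. z \<noteq> y \<and> min x y \<le> z \<and> z \<le> max x y \<and> (z, u) \<in> F"
  using assms(8-10)
proof (induction u rule: less_induct)
  case (less u)
  have d: "d \<in> nodes T" using child_in_nodes assms by blast
  have u: "u \<in> J d" using less.prems assms(5) by (auto simp: time_span_def)
  then have XF: "(X u, u) \<in> F" using access_in_F span_bounds[OF d] by blast
  have Kd: "K d \<subseteq> K v" using child_key_subset[OF bt[OF assms(1)] assms(2)] .
  have Xv: "X u \<in> K v" using X_in_key_span[OF u] Kd by blast
  have Xy: "X u \<noteq> y" using Xv assms(7) by blast
  show ?case
  proof (cases "min x y \<le> X u \<and> X u \<le> max x y")
    case True
    then show ?thesis using XF Xy by blast
  next
    \<comment> \<open>Here \<open>x\<close> lies between the access and \<open>y\<close>, and the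
      case is contradictory: the witness of \<open>(y, u)\<close> must be later than
      \<open>s\<close>, and by induction its row holds a second point in the visible range.\<close>
    case False
    then have x: "min (X u) y \<le> x" "x \<le> max (X u) y" "x \<noteq> y"
      using Xv assms(4,7) mem_key_span[OF bt[OF assms(1)]] by (auto simp: min_def max_def split: if_splits)
    have "gt y u" using outside_greedy[OF less.prems(1) d u less.prems(3)] Kd assms(7) by blast
    from this Xy[symmetric] obtain s' where s': "s' < u" "(y, s') \<in> F"
      "\<And>b t. (b, t) \<in> F \<Longrightarrow> s' \<le> t \<Longrightarrow> t < u \<Longrightarrow> min (X u) y \<le> b \<Longrightarrow> b \<le> max (X u) y \<Longrightarrow>
         b = y \<and> t = s'"
      by (rule greedy_touchedE) blast
    have "s < s'" using s'(3)[OF assms(3) _ less.prems(2) x(1,2)] x(3) by force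
    then obtain z where z: "z \<noteq> y" "min x y \<le> z" "z \<le> max x y" "(z, s') \<in> F"
      using less.IH[OF s'(1,2)] s'(1) less.prems(3) by auto
    moreover have "min (X u) y \<le> z" "z \<le> max (X u) y" using x z by linarith+
    ultimately show ?thesis using s'(3)[of z s'] s'(1) by blast
  qed
qed

text \<open>If the rectangle held only its corners, a Greedy point \<open>(x, t)\<close> would let
  the access also see \<open>y\<close>, past \<open>x\<close>, and \<open>(y, t)\<close> would be a
  third point. For a wing point, either \<open>(y, u)\<close> is in the wing of its own region,
  which again gives \<open>(y, t)\<close>, or \<open>y\<close> lies outside the node and row
  \<open>u\<close> contains another point of the rectangle.\<close>

lemma third_point:
  assumes "(y, u) \<in> F" "(x, t) \<in> F" "u < t" "x \<noteq> y"
  shows "\<exists>z s. (z, s) \<in> F \<and> min x y \<le> z \<and> z \<le> max x y \<and> u \<le> s \<and> s \<le> t \<and>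
    (z, s) \<noteq> (y, u) \<and> (z, s) \<noteq> (x, t)"
proof (rule ccontr)
  assume "\<not> ?thesis"
  then have H: "(z, s) = (y, u) \<or> (z, s) = (x, t)"
    if "(z, s) \<in> F" "min x y \<le> z" "z \<le> max x y" "u \<le> s" "s \<le> t" for z s
    using that by blast
  have yt: "(y, t) \<notin> F" using H[of y t] assms by auto
  have t: "1 \<le> t" "t \<le> n" using F_cases[OF assms(2)] by auto
  show False
  proof (cases "gt x t")
    case True
    have gx: "\<exists>sx<t. (x, sx) \<in> F \<and> (\<forall>b' s'. (b', s') \<in> F \<and> sx \<le> s' \<and> s' < t \<and>
        min (X t) x \<le> b' \<and> b' \<le> max (X t) x \<longrightarrow> b' = x \<and> s' = sx)" if "X t \<noteq> x"
      using True that unfolding greedy_touched_def by auto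
    \<comment> \<open>Otherwise the access lies beyond \<open>y\<close> as seen from
      \<open>x\<close>, and \<open>(y, u)\<close> falls into the range that must be empty for
      \<open>x\<close> to be touched.\<close>
    have a: "X t = x \<or> (min (X t) y \<le> x \<and> x \<le> max (X t) y)"
    proof (rule ccontr)
      assume no: "\<not> ?thesis"
      then obtain sx where sx: "sx < t" "(x, sx) \<in> F"
        "\<And>b' s'. (b', s') \<in> F \<Longrightarrow> sx \<le> s' \<Longrightarrow> s' < t \<Longrightarrow> min (X t) x \<le> b' \<Longrightarrow> b' \<le> max (X t) x \<Longrightarrow>
           b' = x \<and> s' = sx"
        using gx by blast
      have "sx < u" using H[OF sx(2)] sx(1) assms(4) by force
      have "\<not> (min x y \<le> X t \<and> X t \<le> max x y)"
        using H[OF access_in_F[OF t]] assms(3) no by auto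
      then have "min (X t) x \<le> y" "y \<le> max (X t) x" using no by linarith+
      then show False using sx(3)[OF assms(1)] \<open>sx < u\<close> assms(3,4) by simp
    qed
    \<comment> \<open>The range between the access and \<open>(y, u)\<close> splits into the empty
      rectangle and the part between the access and \<open>x\<close>. The latter is empty because
      \<open>x\<close> is visible from a row below \<open>u\<close>.\<close>
    have "gt y t"
      unfolding greedy_touched_def
    proof (intro disjI2 exI[of _ u] conjI allI impI assms)
      fix b s assume bs: "(b, s) \<in> F \<and> u \<le> s \<and> s < t \<and> min (X t) y \<le> b \<and> b \<le> max (X t) y"
      have "min x y \<le> b \<and> b \<le> max x y"
      proof (rule ccontr)
        assume no: "\<not> ?thesis"
        then have "X t \<noteq> x" using bs by auto
        then obtain sx where sx: "sx < t" "(x, sx) \<in> F"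
          "\<And>b' s'. (b', s') \<in> F \<Longrightarrow> sx \<le> s' \<Longrightarrow> s' < t \<Longrightarrow> min (X t) x \<le> b' \<Longrightarrow> b' \<le> max (X t) x \<Longrightarrow>
             b' = x \<and> s' = sx"
          using gx by blast
        have "sx < u" using H[OF sx(2)] sx(1) assms(4) by force
        moreover have "min (X t) x \<le> b" "b \<le> max (X t) x" using no a bs by linarith+
        ultimately have "b = x" using sx(3)[of b s] bs by auto
        then show False using no by auto
      qed
      then show "b = y" "s = u" using H[of b s] bs by auto
    qed
    then show False using greedyI[OF t] yt by blast
  next
    case False
    then obtain v c d S s where *: "v \<in> nodes T" "c \<in> set (children v)" "d \<in> set (children v)" "stop d = t"
      "W t v S" "s < t" "(x, s) \<in> topwing S (K c \<times> J d)" "(x, s) \<in> F" "x \<in> K c" "s \<in> J d" "t \<in> J d"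
      by (rule wing_casesE[OF assms(2)])
    have bv: "block_tree X v" and bc: "block_tree X c" and bd: "block_tree X d"
      using bt btc *(1-3) by auto
    have top: "s' \<le> s" if "(x, s') \<in> S" "s' \<in> J d" for s'
      using *(7) that unfolding mem_topwing[OF bc bd] by blast
    have su: "s < u" using H[OF *(8)] *(6) assms(4) by force
    then have uJ: "u \<in> J d" using *(10,11) assms(3) by (auto simp: time_span_def)
    have uS: "(y, u) \<in> S" using W_lower[OF *(5) assms(1,3)] .
    show False
    proof (cases "y \<in> K v")
      case True
      then obtain c' where c': "c' \<in> set (children v)" "y \<in> K c'"
        using children_key_cover[OF bv] *(2) by force
      have bc': "block_tree X c'" using btc *(1) c'(1) .
      have near: "(b, r) = (y, u)"
        if "(b, r) \<in> S" "min x y \<le> b" "b \<le> max x y" "u \<le> r" "r \<le> t" for b r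
      proof -
        have "(x, t) \<notin> S" using top[of t] *(6,11) by auto
        then show ?thesis using H[OF _ that(2-5)] that(1) W_upper[OF *(5)] by blast
      qed
      have same: "c' = c" if "x \<in> K c'"
        using children_key_eqI[OF bv inj_X c'(1) *(2) that *(9)] .
      have wing: "(\<forall>b r. (b, r) \<in> S \<and> lo c \<le> b \<and> b \<le> x \<and> s \<le> r \<and> r \<le> t \<longrightarrow> b = x \<and> r = s) \<or>
         (\<forall>b r. (b, r) \<in> S \<and> x \<le> b \<and> b \<le> hi c \<and> s \<le> r \<and> r \<le> t \<longrightarrow> b = x \<and> r = s) \<or>
         x = lo c \<or> x = hi c"
        using *(7) unfolding mem_topwing[OF bc bd] *(4) by blast
      have yc: "lo c' \<le> y" "y \<le> hi c'" using mem_key_span[OF bc'] c'(2) by auto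
      \<comment> \<open>On the side of \<open>x\<close> the rectangle is empty up to
        \<open>x\<close> by assumption. Points beyond \<open>x\<close> matter only if both columns
        belong to the same child, and there a point on each side of \<open>x\<close> contradicts
        \<open>(x, s)\<close> being a wing point.\<close>
      have "(y, u) \<in> topwing S (K c' \<times> J d)"
        unfolding mem_topwing[OF bc' bd] *(4)
      proof (intro conjI ballI impI uS c'(2) uJ)
        show "r \<le> u" if "r \<in> J d" "(y, r) \<in> S" for r
        proof (rule ccontr)
          assume "\<not> r \<le> u"
          then show False
            using near[OF that(2)] that(1) *(4) by (auto simp: time_span_def)
        qed
        consider "y < x" | "x < y" using assms(4) by linarith
        then show "(\<forall>b r. (b, r) \<in> S \<and> lo c' \<le> b \<and> b \<le> y \<and> u \<le> r \<and> r \<le> t \<longrightarrow> b = y \<and> r = u) \<or>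
          (\<forall>b r. (b, r) \<in> S \<and> y \<le> b \<and> b \<le> hi c' \<and> u \<le> r \<and> r \<le> t \<longrightarrow> b = y \<and> r = u) \<or>
          y = lo c' \<or> y = hi c'"
        proof cases
          case 1
          have "b = y \<and> r = u" if br: "(b, r) \<in> S" "y \<le> b" "b \<le> hi c'" "u \<le> r" "r \<le> t" for b r
          proof (cases "b \<le> x")
            case True
            then show ?thesis using near[OF br(1) _ _ br(4,5)] br(2) by auto
          next
            case False
            then have "c' = c" using same mem_key_span[OF bc'] yc 1 br(3) by auto
            from wing show ?thesis
            proof (elim disjE)
              assume "\<forall>b r. (b, r) \<in> S \<and> lo c \<le> b \<and> b \<le> x \<and> s \<le> r \<and> r \<le> t \<longrightarrow> b = x \<and> r = s"
              then show ?thesis using uS yc 1 su assms(3) \<open>c' = c\<close> by fastforce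
            next
              assume "\<forall>b r. (b, r) \<in> S \<and> x \<le> b \<and> b \<le> hi c \<and> s \<le> r \<and> r \<le> t \<longrightarrow> b = x \<and> r = s"
              then show ?thesis using br False su \<open>c' = c\<close> by fastforce
            qed (use yc 1 False br(3) \<open>c' = c\<close> in auto)
          qed
          then show ?thesis by blast
        next
          case 2
          have "b = y \<and> r = u" if br: "(b, r) \<in> S" "lo c' \<le> b" "b \<le> y" "u \<le> r" "r \<le> t" for b r
          proof (cases "x \<le> b")
            case True
            then show ?thesis using near[OF br(1) _ _ br(4,5)] br(3) by auto
          next
            case False
            then have "c' = c" using same mem_key_span[OF bc'] yc 2 br(2) by auto
            from wing show ?thesis
            proof (elim disjE)
              assume "\<forall>b r. (b, r) \<in> S \<and> lo c \<le> b \<and> b \<le> x \<and> s \<le> r \<and> r \<le> t \<longrightarrow> b = x \<and> r = s"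
              then show ?thesis using br False su \<open>c' = c\<close> by fastforce
            next
              assume "\<forall>b r. (b, r) \<in> S \<and> x \<le> b \<and> b \<le> hi c \<and> s \<le> r \<and> r \<le> t \<longrightarrow> b = x \<and> r = s"
              then show ?thesis using uS yc 2 su assms(3) \<open>c' = c\<close> by fastforce
            qed (use yc 2 False br(2) \<open>c' = c\<close> in auto)
          qed
          then show ?thesis by blast
        qed
      qed
      then show False using W_touch[OF *(5,1) c'(1) *(3,4)] yt by blast
    next
      case False
      have xv: "x \<in> K v" using child_key_subset[OF bv *(2)] *(9) by blast
      have "(x, s') \<notin> F" if "s < s'" "s' < stop d" for s'
        using top[of s'] W_lower[OF *(5), of x s'] that *(4,10) by (auto simp: time_span_def)
      then obtain z where "z \<noteq> y" "min x y \<le> z" "z \<le> max x y" "(z, u) \<in> F"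
        using row_point_between[OF *(1,3,8) xv *(10) _ False assms(1) su] assms(3) *(4) by blast
      then show False using H[of z u] assms(3) by auto
    qed
  qed
qed

lemma satisfied_F: "satisfied F"
  unfolding satisfied_def
proof (intro ballI impI)
  fix p q assume pq: "p \<in> F" "q \<in> F" "fst p \<noteq> fst q \<and> snd p \<noteq> snd q"
  have *: "\<exists>r. r \<in> F \<inter> rect p q - {p, q}"
    if "p \<in> F" "q \<in> F" "fst p \<noteq> fst q" "snd p < snd q" for p q
  proof -
    have "\<exists>z s. (z, s) \<in> F \<and> min (fst q) (fst p) \<le> z \<and> z \<le> max (fst q) (fst p) \<and>
      snd p \<le> s \<and> s \<le> snd q \<and> (z, s) \<noteq> p \<and> (z, s) \<noteq> q"
      using third_point[of "fst p" "snd p" "fst q" "snd q"] that by simp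
    then obtain z s where "(z, s) \<in> F" "min (fst q) (fst p) \<le> z" "z \<le> max (fst q) (fst p)"
      "snd p \<le> s" "s \<le> snd q" "(z, s) \<noteq> p" "(z, s) \<noteq> q"
      by blast
    then have "(z, s) \<in> F \<inter> rect p q - {p, q}" by (auto simp: rect_def)
    then show ?thesis by blast
  qed
  show "\<exists>r. r \<in> F \<inter> rect p q - {p, q}"
  proof (cases "snd p < snd q")
    case False
    then have "\<exists>r. r \<in> F \<inter> rect q p - {q, p}" using *[of q p] pq by simp
    then show ?thesis by (auto simp: rect_def min.commute max.commute)
  qed (use * pq in simp)
qed

lemma feasible_F: "feasible n X F"
  unfolding feasible_def using finite_F satisfied_F access_in_F by (auto simp: accesses_def)

end

section \<open>The algorithms as fixed-point descriptions\<close>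

lemma greedy_step_eq:
  assumes "\<And>b s. (b, s) \<in> S \<Longrightarrow> s < t"
  shows "greedy_step X t S = S \<union> {(b, t) | b. greedy_touched X S b t}"
proof -
  have "(touched S b (t - 1) \<and>
      rect (X t, t) (b, tau S b (t - 1)) \<inter> {p \<in> S. snd p < t} \<subseteq> {(b, tau S b (t - 1))}) \<longleftrightarrow>
    (\<exists>s<t. (b, s) \<in> S \<and> (\<forall>b' s'. (b', s') \<in> S \<and> s \<le> s' \<and> s' < t \<and>
        min (X t) b \<le> b' \<and> b' \<le> max (X t) b \<longrightarrow> b' = b \<and> s' = s))" (is "?l \<longleftrightarrow> (\<exists>s<t. ?r s)")
    for b
  proof -
    define A where "A = {s. s \<le> t - 1 \<and> (b, s) \<in> S}"
    have tau: "tau S b (t - 1) = Max A" by (simp add: tau_def A_def)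
    have fin: "finite A" by (simp add: A_def)
    have *: "rect (X t, t) (b, s) \<inter> {p \<in> S. snd p < t} \<subseteq> {(b, s)} \<longleftrightarrow>
        (\<forall>b' s'. (b', s') \<in> S \<and> s \<le> s' \<and> s' < t \<and>
          min (X t) b \<le> b' \<and> b' \<le> max (X t) b \<longrightarrow> b' = b \<and> s' = s)" if "s < t" for s
      using that by (simp add: subset_iff mem_rect) (meson less_imp_le)
    show ?thesis
    proof
      assume l: ?l
      then have "A \<noteq> {}" by (auto simp: touched_def A_def)
      then have "Max A \<in> A" using fin Max_in by blast
      then have "Max A < t" "(b, Max A) \<in> S" using assms by (auto simp: A_def)
      then show "\<exists>s<t. ?r s" using l *[of "Max A"] unfolding tau by blast
    next
      assume "\<exists>s<t. ?r s"
      then obtain s where s: "s < t" "?r s" by blast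
      \<comment> \<open>The range of the condition includes column \<open>b\<close>, so a visible
        witness must be its last touch.\<close>
      have "Max A = s"
      proof (rule Max_eqI[OF fin])
        show "s \<in> A" using s by (auto simp: A_def)
        fix y assume "y \<in> A"
        then have "(b, y) \<in> S" "y < t" using assms by (auto simp: A_def)
        then show "y \<le> s" using s(2) by (metis max.cobounded2 min.cobounded2 linear)
      qed
      moreover have "touched S b (t - 1)" using s by (auto simp: touched_def intro!: exI[of _ s])
      ultimately show ?l using s *[OF s(1)] unfolding tau by blast
    qed
  qed
  then show ?thesis unfolding greedy_step_def greedy_touched_def by auto
qed

lemma greedy_touched_cong:
  assumes "\<And>b s. s < t \<Longrightarrow> (b, s) \<in> S \<longleftrightarrow> (b, s) \<in> S'"
  shows "greedy_touched X S b t \<longleftrightarrow> greedy_touched X S' b t"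
  unfolding greedy_touched_def using assms by blast

lemma greedy_step_new: "(b, s) \<in> greedy_step X t S \<Longrightarrow> (b, s) \<notin> S \<Longrightarrow> s = t"
  by (auto simp: greedy_step_def)

lemma greedy_times: "(b, s) \<in> greedy X t \<Longrightarrow> 1 \<le> s \<and> s \<le> t"
proof (induction t)
  case (Suc t)
  then show ?case using greedy_step_new[of b s X "Suc t" "greedy X t"] by fastforce
qed simp

text \<open>Each row depends only on the rows below it, which never change later. Membership can
  therefore be tested against the finished output, and runs can be compared row by row.\<close>

lemma mem_greedy_iff:
  "(b, t) \<in> greedy X n \<longleftrightarrow> 1 \<le> t \<and> t \<le> n \<and> greedy_touched X (greedy X n) b t"
proof (induction n)
  case 0
  then show ?case by simp
next
  case (Suc n)
  have eq: "greedy X (Suc n) = greedy X n \<union> {(b, Suc n) | b. greedy_touched X (greedy X n) b (Suc n)}"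
    using greedy_step_eq[of "greedy X n" "Suc n" X] greedy_times by fastforce
  have same: "(b, s) \<in> greedy X n \<longleftrightarrow> (b, s) \<in> greedy X (Suc n)" if "s < Suc n" for b s
    using that by (auto simp del: greedy.simps simp: eq)
  have gt: "greedy_touched X (greedy X n) b t \<longleftrightarrow> greedy_touched X (greedy X (Suc n)) b t"
    if "t \<le> Suc n" for t
    by (rule greedy_touched_cong) (use same that in auto)
  show ?case
  proof (cases "t = Suc n")
    case True
    then show ?thesis using gt greedy_times[of b "Suc n" X n] by (auto simp del: greedy.simps simp: eq)
  next
    case False
    then show ?thesis
      using Suc gt[of t] greedy_times[of b t X "Suc n"] by (auto simp del: greedy.simps simp: eq)
  qed
qed

text \<open>The access at \<open>stop d\<close> lies in the row of one child only, which fixes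
  \<open>j\<close>; sorting merely rearranges the children, so letting \<open>i\<close> vary gives
  all of them.\<close>

lemma wing_step_eq:
  assumes "block_tree X v" "d \<in> set (children v)"
  shows "wing_step X (stop d) v S = S \<union>
    {(b, stop d) | b. \<exists>c\<in>set (children v). \<exists>s. (b, s) \<in> topwing S (key_span X c \<times> time_span d)}"
proof -
  let ?cs = "children v"
  let ?sc = "sort_key (\<lambda>c. Min (key_span X c)) ?cs"
  have d: "stop d \<in> time_span d" using block_tree_child[OF assms] by simp
  have "(\<exists>q i j. (b, t) = (fst q, stop d) \<and> i < length ?cs \<and> j < length ?cs \<and>
        (X (stop d), stop d) \<in> key_span X (?cs ! j) \<times> time_span (?cs ! j) \<and>
        q \<in> topwing S (region X v i j)) \<longleftrightarrow>
      t = stop d \<and> (\<exists>c\<in>set ?cs. \<exists>s. (b, s) \<in> topwing S (key_span X c \<times> time_span d))"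
    (is "?l \<longleftrightarrow> ?r") for b t
  proof
    assume ?l
    then obtain q i j where *: "b = fst q" "t = stop d" "i < length ?cs" "j < length ?cs"
      "stop d \<in> time_span (?cs ! j)" "q \<in> topwing S (region X v i j)"
      by auto
    have "?cs ! j = d"
      using children_eqI[OF assms(1) _ assms(2) _ d] * by simp
    moreover have "?sc ! i \<in> set ?cs" using *(3) by (metis length_sort nth_mem set_sort)
    ultimately show ?r using * unfolding region_def by (metis prod.collapse)
  next
    assume ?r
    then obtain c s where *: "t = stop d" "c \<in> set ?cs" "(b, s) \<in> topwing S (key_span X c \<times> time_span d)"
      by blast
    obtain i where i: "i < length ?cs" "?sc ! i = c"
      using *(2) by (metis in_set_conv_nth length_sort set_sort)
    obtain j where j: "j < length ?cs" "?cs ! j = d"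
      using assms(2) by (metis in_set_conv_nth)
    show ?l
      using * i j d X_in_key_span[OF d, of X]
      by (intro exI[of _ "(b, s)"] exI[of _ i] exI[of _ j]) (simp add: region_def)
  qed
  then show ?thesis unfolding wing_step_def by (auto simp: set_eq_iff)
qed

section \<open>Stages within one time step of RGreedy\<close>

lemma fold_wing_mono: "S \<subseteq> fold (wing_step X t) L S"
proof (induction L arbitrary: S)
  case (Cons v L)
  have "S \<subseteq> wing_step X t v S" by (auto simp: wing_step_def)
  then show ?case using Cons[of "wing_step X t v S"] by auto
qed simp

text \<open>This isolates the step that inserts \<open>p\<close>. That \<open>p\<close> is missing
  just before it will force the wing point responsible for \<open>p\<close> to be strictly
  earlier.\<close>

lemma fold_wing_cases:
  "p \<in> fold (wing_step X t) L S \<Longrightarrow> p \<in> S \<or>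
    (\<exists>L1 v L2. L = L1 @ v # L2 \<and> p \<in> wing_step X t v (fold (wing_step X t) L1 S) \<and>
       p \<notin> fold (wing_step X t) L1 S)"
proof (induction L rule: rev_induct)
  case (snoc v L)
  show ?case
  proof (cases "p \<in> fold (wing_step X t) L S")
    case True
    then show ?thesis using snoc.IH by (metis append_Cons append_assoc)
  next
    case False
    then show ?thesis using snoc.prems by (intro disjI2 exI[of _ L] exI[of _ v] exI[of _ "[]"]) simp
  qed
qed simp

lemma wing_step_new: "p \<in> wing_step X t v S \<Longrightarrow> p \<notin> S \<Longrightarrow> snd p = t"
  by (auto simp: wing_step_def)

lemma fold_wing_new: "(b, s) \<in> fold (wing_step X t) L S \<Longrightarrow> (b, s) \<notin> S \<Longrightarrow> s = t"
  using fold_wing_cases[of "(b, s)" X t L S] wing_step_new[of "(b, s)" X t] by auto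

lemma rgreedy_times: "(b, s) \<in> rgreedy X T t \<Longrightarrow> 1 \<le> s \<and> s \<le> t"
proof (induction t)
  case (Suc t)
  then show ?case
    using fold_wing_new[of b s X "Suc t"] greedy_step_new[of b s X "Suc t" "rgreedy X T t"]
    by fastforce
qed simp

lemma rgreedy_step_eq:
  "greedy_step X (Suc t) (rgreedy X T t) =
      rgreedy X T t \<union> {(b, Suc t) | b. greedy_touched X (rgreedy X T t) b (Suc t)}"
  by (rule greedy_step_eq) (use rgreedy_times in \<open>simp add: less_Suc_eq_le\<close>)

lemma rgreedy_below:
  assumes "t \<le> n" "s \<le> t"
  shows "(b, s) \<in> rgreedy X T n \<longleftrightarrow> (b, s) \<in> rgreedy X T t"
  using assms(1)
proof (induction n rule: dec_induct)
  case (step n)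
  have "(b, s) \<in> rgreedy X T (Suc n) \<longleftrightarrow> (b, s) \<in> rgreedy X T n"
  proof
    assume "(b, s) \<in> rgreedy X T (Suc n)"
    then have "(b, s) \<in> greedy_step X (Suc n) (rgreedy X T n)"
      using fold_wing_new[of b s X "Suc n"] assms step by fastforce
    then show "(b, s) \<in> rgreedy X T n"
      unfolding rgreedy_step_eq using assms step by auto
  next
    assume "(b, s) \<in> rgreedy X T n"
    then show "(b, s) \<in> rgreedy X T (Suc n)"
      using fold_wing_mono rgreedy_step_eq by fastforce
  qed
  then show ?case using step by simp
qed simp

definition before_wing :: "(nat \<Rightarrow> nat) \<Rightarrow> btree \<Rightarrow> nat \<Rightarrow> nat \<Rightarrow> btree \<Rightarrow> point set \<Rightarrow> bool" where
  "before_wing X T n t v S \<longleftrightarrow> 1 \<le> t \<and> t \<le> n \<and>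
     (\<exists>L1 L2. end_parents t T = L1 @ v # L2 \<and>
        S = fold (wing_step X t) L1 (greedy_step X t (rgreedy X T (t - 1))))"

lemma rgreedy_output_rgreedy:
  assumes "X permutes {1..n}" "block_decomposition_tree n X T"
  shows "rgreedy_output X n T (rgreedy X T n) (before_wing X T n)"
proof
  let ?F = "rgreedy X T n"
  show tree: "block_tree X T" and span: "time_span T = {1..n}"
    using assms(2) by (auto simp: block_decomposition_tree_def time_span_def)
  show "X permutes {1..n}" using assms(1) .
  have row: "\<exists>G. greedy_step X t (rgreedy X T (t - 1)) = G \<and>
      G = rgreedy X T (t - 1) \<union> {(b, t) | b. greedy_touched X ?F b t} \<and>
      rgreedy X T t = fold (wing_step X t) (end_parents t T) G" if "1 \<le> t" "t \<le> n" for t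
  proof -
    define t' where "t' = t - 1"
    have t': "t = Suc t'" using that by (simp add: t'_def)
    have "greedy_touched X (rgreedy X T t') b t \<longleftrightarrow> greedy_touched X ?F b t" for b
      by (rule greedy_touched_cong) (subst rgreedy_below[of t' n], use that t' in auto)
    then show ?thesis using rgreedy_step_eq[of X t' T] t' by simp
  qed
  have tF: "(b, s) \<in> ?F" if "(b, s) \<in> rgreedy X T t" "t \<le> n" for b s t
    using rgreedy_below[OF that(2)] rgreedy_times[OF that(1)] that(1) by blast
  show "(b, t) \<in> ?F" if "1 \<le> t" "t \<le> n" "greedy_touched X ?F b t" for b t
  proof -
    have "(b, t) \<in> rgreedy X T t"
      using row[OF that(1,2)] that(3) fold_wing_mono by blast
    then show ?thesis using tF that by blast
  qed
  show "(b, s) \<in> S" if "before_wing X T n t v S" "(b, s) \<in> ?F" "s < t" for t v S b s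
  proof -
    have "(b, s) \<in> rgreedy X T (t - 1)"
      using rgreedy_below[of "t - 1" n s b X T] that by (auto simp: before_wing_def)
    then show ?thesis
      using that(1) row[of t] fold_wing_mono unfolding before_wing_def by blast
  qed
  show upper: "(b, s) \<in> ?F \<and> s \<le> t" if before: "before_wing X T n t v S" and bs: "(b, s) \<in> S" for t v S b s
  proof -
    obtain L1 L2 where L: "end_parents t T = L1 @ v # L2" "1 \<le> t" "t \<le> n"
      "S = fold (wing_step X t) L1 (greedy_step X t (rgreedy X T (t - 1)))"
      using before(1) by (auto simp: before_wing_def)
    have "rgreedy X T t = fold (wing_step X t) (v # L2) S"
      using row[OF L(2,3)] L by auto
    then have "(b, s) \<in> rgreedy X T t" using fold_wing_mono bs by blast
    then show ?thesis using tF L rgreedy_times by blast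
  qed
  show "(b, t) \<in> ?F"
    if before: "before_wing X T n t v S" "v \<in> nodes T" "c \<in> set (children v)" "d \<in> set (children v)"
      "stop d = t" "(b, s) \<in> topwing S (key_span X c \<times> time_span d)" for t v S c d b s
  proof -
    obtain L1 L2 where L: "end_parents t T = L1 @ v # L2" "1 \<le> t" "t \<le> n"
      "S = fold (wing_step X t) L1 (greedy_step X t (rgreedy X T (t - 1)))"
      using before(1) by (auto simp: before_wing_def)
    have "rgreedy X T t = fold (wing_step X t) L2 (wing_step X t v S)"
      using row[OF L(2,3)] L by auto
    moreover have "(b, t) \<in> wing_step X t v S"
      using wing_step_eq[OF block_tree_node[OF tree before(2)] before(4)] before by blast
    ultimately have "(b, t) \<in> rgreedy X T t" using fold_wing_mono by blast
    then show ?thesis using tF L by blast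
  qed
  show "\<exists>S. before_wing X T n t v S"
    if node: "v \<in> nodes T" "d \<in> set (children v)" "stop d = t" for t v d
  proof -
    have "t \<in> time_span d"
      using block_tree_child[OF block_tree_node[OF tree node(1)] node(2)] node(3) by auto
    then have "t \<in> {1..n}"
      using node_time_subset[OF tree child_in_nodes[OF node(1,2)]] span by blast
    moreover have "v \<in> set (end_parents t T)" using node by (auto simp: set_end_parents)
    then obtain L1 L2 where "end_parents t T = L1 @ v # L2" by (meson split_list)
    ultimately show ?thesis unfolding before_wing_def by auto
  qed
  show "1 \<le> t \<and> t \<le> n \<and> (greedy_touched X ?F b t \<or>
      (\<exists>v\<in>nodes T. \<exists>c\<in>set (children v). \<exists>d\<in>set (children v). stop d = t \<and>
        (\<exists>S s. before_wing X T n t v S \<and> s < t \<and> (b, s) \<in> topwing S (key_span X c \<times> time_span d))))"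
    if "(b, t) \<in> ?F" for b t
  proof -
    have t: "1 \<le> t" "t \<le> n" using rgreedy_times that by auto
    define G where "G = greedy_step X t (rgreedy X T (t - 1))"
    have G: "G = rgreedy X T (t - 1) \<union> {(b, t) | b. greedy_touched X ?F b t}"
      "rgreedy X T t = fold (wing_step X t) (end_parents t T) G" using row[OF t] by (auto simp: G_def)
    have "(b, t) \<in> rgreedy X T t" using rgreedy_below[OF t(2)] that by blast
    then consider "(b, t) \<in> G" | L1 v L2 where "end_parents t T = L1 @ v # L2"
        "(b, t) \<in> wing_step X t v (fold (wing_step X t) L1 G)" "(b, t) \<notin> fold (wing_step X t) L1 G"
      using fold_wing_cases unfolding G(2) by blast
    then show ?thesis
    proof cases
      case 1
      then have "greedy_touched X ?F b t" using G(1) rgreedy_times[of b t X T "t - 1"] t by auto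
      then show ?thesis using t by blast
    next
      case (2 L1 v L2)
      define S where "S = fold (wing_step X t) L1 G"
      have S: "before_wing X T n t v S" using 2 t by (auto simp: before_wing_def S_def G_def)
      have "v \<in> set (end_parents t T)" using 2 by simp
      then obtain d where d: "v \<in> nodes T" "d \<in> set (children v)" "stop d = t"
        by (auto simp: set_end_parents)
      then obtain c s where c: "c \<in> set (children v)" "(b, s) \<in> topwing S (key_span X c \<times> time_span d)"
        using wing_step_eq[OF block_tree_node[OF tree d(1)] d(2)] 2 by (auto simp: S_def)
      then have "(b, s) \<in> S" by (auto simp: topwing_def)
      \<comment> \<open>A wing point of column \<open>b\<close> in row \<open>t\<close> would be
        \<open>(b, t)\<close> itself, which is absent before this step.\<close>
      then have "s \<le> t" "s \<noteq> t" using upper[OF S] 2(3) by (auto simp: S_def)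
      then show ?thesis using t d c S by (metis le_neq_implies_less)
    qed
  qed
qed

section \<open>Quotient permutations\<close>

text \<open>Children are numbered from 1, to match times of the quotient permutation.\<close>

definition child :: "btree \<Rightarrow> nat \<Rightarrow> btree" where
  "child v j = children v ! (j - 1)"

text \<open>The rank of a child's key interval among all children, that is, the order pattern of the
  blocks. Outside the index range it is the identity, as \<open>permutes\<close> demands.\<close>

definition quotient_perm :: "(nat \<Rightarrow> nat) \<Rightarrow> btree \<Rightarrow> nat \<Rightarrow> nat" where
  "quotient_perm X v j = (if j \<in> {1..length (children v)}
     then card {m \<in> {1..length (children v)}. low_key X (child v m) \<le> low_key X (child v j)} else j)"

lemma child_mem: "j \<in> {1..length (children v)} \<Longrightarrow> child v j \<in> set (children v)"
  by (auto simp: child_def)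

lemma child_ex:
  assumes "c \<in> set (children v)"
  obtains j where "j \<in> {1..length (children v)}" "c = child v j"
proof -
  obtain i where "i < length (children v)" "c = children v ! i"
    using assms by (metis in_set_conv_nth)
  then show ?thesis using that[of "Suc i"] by (simp add: child_def)
qed

locale block_node =
  fixes X :: "nat \<Rightarrow> nat" and v :: btree
  assumes block_v: "block_tree X v" and inj: "inj X"
begin

abbreviation "k \<equiv> length (children v)"
abbreviation "Q \<equiv> quotient_perm X v"
abbreviation "ch \<equiv> child v"

lemma block_ch: "j \<in> {1..k} \<Longrightarrow> block_tree X (ch j)"
  using block_tree_child[OF block_v] child_mem by blast

lemma ch_before:
  assumes "i < j" "i \<in> {1..k}" "j \<in> {1..k}"
  shows "stop (ch i) < start (ch j)"
  using children_before[OF block_v, of "i - 1" "j - 1"] assms by (auto simp: child_def)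

lemma time_index_mono:
  assumes "i \<in> {1..k}" "j \<in> {1..k}" "s \<in> time_span (ch i)" "t \<in> time_span (ch j)" "s \<le> t"
  shows "i \<le> j"
proof (rule ccontr)
  assume "\<not> i \<le> j"
  then show False using ch_before[of j i] assms by (auto simp: time_span_def)
qed

lemma ch_inj:
  assumes "i \<in> {1..k}" "j \<in> {1..k}" "ch i = ch j"
  shows "i = j"
proof -
  have "start (ch i) \<in> time_span (ch i)" using block_ch[OF assms(1)] by simp
  then show ?thesis
    using time_index_mono[OF assms(1,2)] time_index_mono[OF assms(2,1)] assms(3) by (metis le_antisym order_refl)
qed

text \<open>Key intervals of different children are disjoint, so a single pair of keys decides the
  order of the intervals.\<close>

lemma low_key_mono:
  assumes "i \<in> {1..k}" "j \<in> {1..k}" "x \<in> key_span X (ch i)" "y \<in> key_span X (ch j)" "x \<le> y"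
  shows "low_key X (ch i) \<le> low_key X (ch j)"
proof (rule ccontr)
  assume no: "\<not> ?thesis"
  moreover have "low_key X (ch i) \<le> x" "y \<le> high_key X (ch j)" "low_key X (ch j) \<le> y"
    using assms mem_key_span block_ch by blast+
  ultimately have "x \<in> key_span X (ch j)"
    using mem_key_span[OF block_ch[OF assms(2)]] assms(5) by simp
  then have "ch i = ch j"
    using children_key_eqI[OF block_v inj child_mem[OF assms(1)] child_mem[OF assms(2)] assms(3)] by blast
  then show False using no by simp
qed

lemma low_key_inj:
  assumes "i \<in> {1..k}" "j \<in> {1..k}" "low_key X (ch i) = low_key X (ch j)"
  shows "i = j"
proof -
  have "low_key X (ch i) \<in> key_span X (ch i)" "low_key X (ch j) \<in> key_span X (ch j)"
    using key_span_eq[OF block_ch[OF assms(1)]] key_span_eq[OF block_ch[OF assms(2)]] by auto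
  then have "ch i = ch j"
    using children_key_eqI[OF block_v inj child_mem[OF assms(1)] child_mem[OF assms(2)]] assms(3) by simp
  then show ?thesis using ch_inj assms by blast
qed

lemma quotient_le_iff:
  assumes "i \<in> {1..k}" "j \<in> {1..k}"
  shows "Q i \<le> Q j \<longleftrightarrow> low_key X (ch i) \<le> low_key X (ch j)"
proof -
  define A where "A j = {m \<in> {1..k}. low_key X (ch m) \<le> low_key X (ch j)}" for j
  have Q: "Q i = card (A i)" "Q j = card (A j)" using assms by (auto simp: quotient_perm_def A_def)
  have fin: "finite (A m)" for m by (simp add: A_def)
  show ?thesis
  proof
    assume "low_key X (ch i) \<le> low_key X (ch j)"
    then have "A i \<subseteq> A j" by (auto simp: A_def)
    then show "Q i \<le> Q j" unfolding Q using card_mono fin by blast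
  next
    assume le: "Q i \<le> Q j"
    show "low_key X (ch i) \<le> low_key X (ch j)"
    proof (rule ccontr)
      assume "\<not> ?thesis"
      then have "A j \<subseteq> A i" "i \<in> A i" "i \<notin> A j" using assms by (auto simp: A_def)
      then have "A j \<subset> A i" by blast
      then have "card (A j) < card (A i)" using psubset_card_mono[OF fin] by blast
      then show False using le Q by linarith
    qed
  qed
qed

lemma quotient_inj:
  assumes "i \<in> {1..k}" "j \<in> {1..k}" "Q i = Q j"
  shows "i = j"
proof -
  have "low_key X (ch i) \<le> low_key X (ch j)" "low_key X (ch j) \<le> low_key X (ch i)"
    using quotient_le_iff[OF assms(1,2)] quotient_le_iff[OF assms(2,1)] assms(3) by auto
  then show ?thesis using low_key_inj[OF assms(1,2)] by linarith
qed

lemma quotient_permutes: "Q permutes {1..k}"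
proof (rule bij_imp_permutes)
  have "Q j \<in> {1..k}" if "j \<in> {1..k}" for j
  proof -
    define A where "A = {m \<in> {1..k}. low_key X (ch m) \<le> low_key X (ch j)}"
    have "j \<in> A" "A \<subseteq> {1..k}" using that by (auto simp: A_def)
    then have "card A \<le> card {1..k}" "1 \<le> card A"
      using card_mono[of "{1..k}" A] card_gt_0_iff[of A] finite_subset[of A "{1..k}"]
      by (auto simp: Suc_le_eq)
    then show ?thesis using that by (simp add: quotient_perm_def A_def)
  qed
  then have "Q ` {1..k} \<subseteq> {1..k}" by blast
  moreover have "inj_on Q {1..k}" using quotient_inj by (auto simp: inj_on_def)
  ultimately show "bij_betw Q {1..k} {1..k}"
    by (simp add: bij_betw_def endo_inj_surj)
qed (auto simp: quotient_perm_def)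

lemma key_rank_mono:
  assumes "i \<in> {1..k}" "j \<in> {1..k}" "x \<in> key_span X (ch i)" "y \<in> key_span X (ch j)" "x \<le> y"
  shows "Q i \<le> Q j"
  using low_key_mono[OF assms] quotient_le_iff[OF assms(1,2)] by blast

lemma rank_between:
  assumes "i \<in> {1..k}" "j \<in> {1..k}" "m \<in> {1..k}"
    and "x \<in> key_span X (ch i)" "y \<in> key_span X (ch j)" "z \<in> key_span X (ch m)"
    and "min x y \<le> z" "z \<le> max x y"
  shows "min (Q i) (Q j) \<le> Q m" "Q m \<le> max (Q i) (Q j)"
proof -
  consider "x \<le> z" "z \<le> y" | "y \<le> z" "z \<le> x" using assms(7,8) by linarith
  then have "Q i \<le> Q m \<and> Q m \<le> Q j \<or> Q j \<le> Q m \<and> Q m \<le> Q i"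
  proof cases
    case 1
    then show ?thesis using key_rank_mono[OF assms(1,3,4,6)] key_rank_mono[OF assms(3,2,6,5)] by blast
  next
    case 2
    then show ?thesis using key_rank_mono[OF assms(2,3,5,6)] key_rank_mono[OF assms(3,1,6,4)] by blast
  qed
  then show "min (Q i) (Q j) \<le> Q m" "Q m \<le> max (Q i) (Q j)" by auto
qed

text \<open>Ranks cannot order two keys of the same child; the converse of
  \<open>rank_between\<close> therefore asks that \<open>m\<close> differ from both outer
  children.\<close>

lemma key_between:
  assumes "i \<in> {1..k}" "j \<in> {1..k}" "m \<in> {1..k}" "m \<noteq> i" "m \<noteq> j"
    and "x \<in> key_span X (ch i)" "y \<in> key_span X (ch j)" "z \<in> key_span X (ch m)"
    and "min (Q i) (Q j) \<le> Q m" "Q m \<le> max (Q i) (Q j)"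
  shows "min x y \<le> z" "z \<le> max x y"
proof -
  have "Q m \<noteq> Q i" "Q m \<noteq> Q j" using quotient_inj assms(1-5) by blast+
  then consider "Q i < Q m" "Q m < Q j" | "Q j < Q m" "Q m < Q i"
    using assms(9,10) by linarith
  then have "x < z \<and> z < y \<or> y < z \<and> z < x"
  proof cases
    case 1
    then show ?thesis
      using key_rank_mono[OF assms(3,1,8,6)] key_rank_mono[OF assms(2,3,7,8)] by (meson not_le)
  next
    case 2
    then show ?thesis
      using key_rank_mono[OF assms(1,3,6,8)] key_rank_mono[OF assms(3,2,8,7)] by (meson not_le)
  qed
  then show "min x y \<le> z" "z \<le> max x y" by auto
qed

lemma time_ch:
  assumes "s \<in> time_span v" "children v \<noteq> []"
  obtains j where "j \<in> {1..k}" "s \<in> time_span (ch j)"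
proof -
  obtain c where "c \<in> set (children v)" "s \<in> time_span c"
    using children_time_cover[OF block_v assms(2)] assms(1) by blast
  then show ?thesis using that child_ex by metis
qed

lemma key_ch:
  assumes "b \<in> key_span X v" "children v \<noteq> []"
  obtains m where "m \<in> {1..k}" "b \<in> key_span X (ch m)"
proof -
  obtain c where "c \<in> set (children v)" "b \<in> key_span X c"
    using children_key_cover[OF block_v assms(2)] assms(1) by blast
  then show ?thesis using that child_ex by metis
qed

end

section \<open>Occupied regions and Greedy on the quotient\<close>

lemma greedy_access_time:
  "(b, t) \<in> greedy X n \<Longrightarrow> \<exists>r. 1 \<le> r \<and> r \<le> t \<and> X r = b"
proof (induction t rule: less_induct)
  case (less t)
  have t: "1 \<le> t" "t \<le> n" "greedy_touched X (greedy X n) b t"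
    using mem_greedy_iff less.prems by blast+
  show ?case
  proof (cases "b = X t")
    case False
    from t(3) this obtain s where "s < t" "(b, s) \<in> greedy X n" by (rule greedy_touchedE) blast
    then show ?thesis using less.IH[of s] by auto
  qed (use t in auto)
qed

context rgreedy_output
begin

lemma block_node: "v \<in> nodes T \<Longrightarrow> block_node X v"
  using bt inj_X by unfold_locales

text \<open>
  Every nonempty region of an earlier row contains a point in its last row, so comparing last touch
  times of columns in different key intervals amounts to comparing row indices; this makes the strict
  records seen by Greedy the same at both scales.
\<close>

lemma greedy_quotient:
  assumes v: "v \<in> nodes T" and jm: "j \<in> {1..length (children v)}" "m \<in> {1..length (children v)}"
  shows "(\<exists>b\<in>K (child v m). gt b (start (child v j))) \<longleftrightarrow>
    (quotient_perm X v m, j) \<in> greedy (quotient_perm X v) (length (children v))"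
  using jm
proof (induction j arbitrary: m rule: less_induct)
  case (less j)
  interpret block_node X v using block_node[OF v] .
  let ?G = "greedy Q k"
  let ?s0 = "start (ch j)"
  have ne: "children v \<noteq> []" using less.prems by auto
  have chv: "ch i \<in> set (children v)" "ch i \<in> nodes T" if "i \<in> {1..k}" for i
    using child_mem[OF that] child_in_nodes[OF v] by auto
  have s0: "?s0 \<in> J (ch j)" using block_ch[OF less.prems(1)] by simp
  have s0v: "?s0 \<in> J v" using s0 child_time_subset[OF block_v chv(1)[OF less.prems(1)]] by blast
  have s0n: "1 \<le> ?s0" "?s0 \<le> n" using span_bounds[OF v s0v] by auto
  have XK: "X ?s0 \<in> K (ch j)" using X_in_key_span s0 .
  \<comment> \<open>Rows before \<open>j\<close> avoid the last time of \<open>v\<close>, so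
    \<open>region_touched_at_start\<close> applies to them, and the induction hypothesis turns
    occupied regions into Greedy points.\<close>
  have N: "(\<exists>b\<in>K (ch i). \<exists>s\<in>J (ch j'). (b, s) \<in> F) \<longleftrightarrow> (Q i, j') \<in> ?G"
    if "j' < j" "j' \<in> {1..k}" "i \<in> {1..k}" for i j'
  proof -
    have "(\<exists>b\<in>K (ch i). \<exists>s\<in>J (ch j'). (b, s) \<in> F) \<longleftrightarrow> (\<exists>b\<in>K (ch i). gt b (start (ch j')))"
    proof
      assume "\<exists>b\<in>K (ch i). \<exists>s\<in>J (ch j'). (b, s) \<in> F"
      then obtain b s where bs: "b \<in> K (ch i)" "s \<in> J (ch j')" "(b, s) \<in> F" by blast
      have "s < ?s0" using ch_before[OF that(1,2) less.prems(1)] bs by (auto simp: time_span_def)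
      then have "s \<noteq> stop v" using s0v by (auto simp: time_span_def)
      then show "\<exists>b\<in>K (ch i). gt b (start (ch j'))"
        using region_touched_at_start[OF v chv(1)[OF that(3)] chv(1)[OF that(2)] bs(3,1,2)] by blast
    next
      assume "\<exists>b\<in>K (ch i). gt b (start (ch j'))"
      then obtain b where b: "b \<in> K (ch i)" "gt b (start (ch j'))" by blast
      have "start (ch j') \<in> J (ch j')" using block_ch[OF that(2)] by simp
      moreover from this have "(b, start (ch j')) \<in> F"
        using greedyI b span_bounds[OF chv(2)[OF that(2)]] by blast
      ultimately show "\<exists>b\<in>K (ch i). \<exists>s\<in>J (ch j'). (b, s) \<in> F" using b by blast
    qed
    then show ?thesis using less.IH[OF that] by simp
  qed
  have G: "\<exists>i\<in>{1..k}. i' = Q i" "j' \<in> {1..k}" if "(i', j') \<in> ?G" for i' j'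
    using greedy_access_time[OF that] greedy_times[OF that] by fastforce+
  have earlier: "j' < j" if "s \<in> J (ch j')" "s < ?s0" "j' \<in> {1..k}" for s j'
  proof -
    have "j' \<le> j" using time_index_mono[OF that(3) less.prems(1) that(1) s0] that(2) by simp
    moreover have "j' \<noteq> j" using that(1,2) by (auto simp: time_span_def)
    ultimately show ?thesis by simp
  qed
  have in_v: "\<exists>j'\<in>{1..k}. s \<in> J (ch j')" if "(b, s) \<in> F" "b \<in> K v" "s < ?s0" for b s
  proof -
    have "s \<in> J v" using key_time_start[OF that(2,1)] that(3) s0v by (auto simp: time_span_def)
    then show ?thesis using time_ch[OF _ ne] by metis
  qed
  have Kv: "K (ch i) \<subseteq> K v" if "i \<in> {1..k}" for i
    using child_key_subset[OF block_v chv(1)[OF that]] .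
  have GQ: "(Q m, j) \<in> ?G \<longleftrightarrow> greedy_touched Q ?G (Q m) j"
    using mem_greedy_iff[of "Q m" j Q k] less.prems by auto
  show ?case
  proof (cases "m = j")
    case True
    have "gt (X ?s0) ?s0" "greedy_touched Q ?G (Q j) j" by (auto simp: greedy_touched_def)
    then show ?thesis using GQ XK True by blast
  next
    case False
    then have QQ: "Q m \<noteq> Q j" using quotient_inj less.prems by blast
    show ?thesis unfolding GQ
    proof
      assume "\<exists>b\<in>K (ch m). gt b ?s0"
      then obtain b where b: "b \<in> K (ch m)" "gt b ?s0" by blast
      have "b \<noteq> X ?s0"
        using b XK False ch_inj[OF less.prems(2,1)]
          children_key_eqI[OF block_v inj chv(1)[OF less.prems(2)] chv(1)[OF less.prems(1)]] by blast
      from b(2) this obtain s where s: "s < ?s0" "(b, s) \<in> F"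
        "\<And>b' s'. (b', s') \<in> F \<Longrightarrow> s \<le> s' \<Longrightarrow> s' < ?s0 \<Longrightarrow> min (X ?s0) b \<le> b' \<Longrightarrow> b' \<le> max (X ?s0) b \<Longrightarrow>
           b' = b \<and> s' = s"
        by (rule greedy_touchedE) blast
      \<comment> \<open>The quotient witness will be the last row before \<open>j\<close> in which
        Greedy touches \<open>Q m\<close>; it is no earlier than the row containing
        \<open>s\<close>.\<close>
      define A where "A = {j' \<in> {1..k}. j' < j \<and> (Q m, j') \<in> ?G}"
      obtain j1 where j1: "j1 \<in> {1..k}" "s \<in> J (ch j1)" using in_v s b Kv less.prems by blast
      have "j1 \<in> A" using N[OF earlier[OF j1(2) s(1) j1(1)] j1(1) less.prems(2)] earlier[OF j1(2) s(1) j1(1)] j1 s b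
        by (auto simp: A_def)
      then have A: "finite A" "A \<noteq> {}" by (auto simp: A_def)
      define j0 where "j0 = Max A"
      have j0: "j0 \<in> A" and maxA: "\<And>i. i \<in> A \<Longrightarrow> i \<le> j0"
        using Max_in[OF A] Max_ge[OF A(1)] by (auto simp: j0_def)
      have j0': "j0 \<in> {1..k}" "j0 < j" "(Q m, j0) \<in> ?G" using j0 by (auto simp: A_def)
      have "s \<le> stop (ch j0)"
      proof (cases "j1 = j0")
        case False
        then have "j1 < j0" using maxA[OF \<open>j1 \<in> A\<close>] by simp
        then show ?thesis
          using ch_before[OF _ j1(1) j0'(1)] j1(2) block_tree_start_le_stop[OF block_ch[OF j0'(1)]]
          by (auto simp: time_span_def)
      qed (use j1 in \<open>auto simp: time_span_def\<close>)
      have "i' = Q m \<and> j' = j0"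
        if G': "(i', j') \<in> ?G" "j0 \<le> j'" "j' < j" "min (Q j) (Q m) \<le> i'" "i' \<le> max (Q j) (Q m)" for i' j'
      proof -
        obtain i where i: "i \<in> {1..k}" "i' = Q i" using G(1)[OF G'(1)] by blast
        have j': "j' \<in> {1..k}" using G(2)[OF G'(1)] .
        obtain b1 s1 where b1: "b1 \<in> K (ch i)" "s1 \<in> J (ch j')" "(b1, s1) \<in> F"
          using N[OF G'(3) j' i(1)] G'(1) i(2) by blast
        show ?thesis
        proof (cases "i = m")
          case True
          then have "j' \<in> A" using G'(1,3) j' i(2) by (auto simp: A_def)
          then show ?thesis using maxA G'(2) i True by force
        next
          case im: False
          have "i \<noteq> j"
          proof
            assume "i = j"
            then have "?s0 \<le> s1" using key_time_start[OF b1(1,3)] by simp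
            then show False using ch_before[OF G'(3) j' less.prems(1)] b1(2) by (auto simp: time_span_def)
          qed
          \<comment> \<open>Moving to the last row of the region makes the point at least as recent
            as \<open>s\<close>, so it falls into the range seen from the access.\<close>
          obtain b2 where b2: "b2 \<in> K (ch i)" "(b2, stop (ch j')) \<in> F"
            using region_touched_at_stop[OF v chv(1)[OF i(1)] chv(1)[OF j'] b1(3,2,1)] by blast
          have "min (X ?s0) b \<le> b2" "b2 \<le> max (X ?s0) b"
            using key_between[OF less.prems i(1) \<open>i \<noteq> j\<close> im XK b(1) b2(1)] G' i by auto
          moreover have "s \<le> stop (ch j')"
          proof (cases "j' = j0")
            case False
            then have "j0 < j'" using G'(2) by simp
            then show ?thesis
              using ch_before[OF _ j0'(1) j'] \<open>s \<le> stop (ch j0)\<close> block_tree_start_le_stop[OF block_ch[OF j']]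
              by fastforce
          qed (use \<open>s \<le> stop (ch j0)\<close> in simp)
          ultimately have "b2 = b"
            using s(3)[OF b2(2)] ch_before[OF G'(3) j' less.prems(1)] by blast
          then show ?thesis
            using b b2(1) im ch_inj[OF i(1) less.prems(2)]
              children_key_eqI[OF block_v inj chv(1)[OF i(1)] chv(1)[OF less.prems(2)]] by blast
        qed
      qed
      then show "greedy_touched Q ?G (Q m) j"
        unfolding greedy_touched_def using j0' by blast
    next
      assume "greedy_touched Q ?G (Q m) j"
      from this QQ obtain j0 where j0: "j0 < j" "(Q m, j0) \<in> ?G"
        "\<And>i' j'. (i', j') \<in> ?G \<Longrightarrow> j0 \<le> j' \<Longrightarrow> j' < j \<Longrightarrow> min (Q j) (Q m) \<le> i' \<Longrightarrow> i' \<le> max (Q j) (Q m) \<Longrightarrow>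
           i' = Q m \<and> j' = j0"
        by (rule greedy_touchedE) blast
      have j0': "j0 \<in> {1..k}" using G(2)[OF j0(2)] .
      define A where "A = {s. s < ?s0 \<and> (\<exists>b\<in>K (ch m). (b, s) \<in> F)}"
      obtain b1 s1 where b1: "b1 \<in> K (ch m)" "s1 \<in> J (ch j0)" "(b1, s1) \<in> F"
        using N[OF j0(1) j0' less.prems(2)] j0(2) by blast
      have "s1 < ?s0" using ch_before[OF j0(1) j0' less.prems(1)] b1(2) by (auto simp: time_span_def)
      then have "s1 \<in> A" using b1 by (auto simp: A_def)
      then have A: "finite A" "A \<noteq> {}" by (auto simp: A_def)
      \<comment> \<open>The last time before the block \<open>ch j\<close> at which any column of
        child \<open>m\<close> is used. Among the columns used then, the one nearest to the access
        is visible.\<close>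
      define s where "s = Max A"
      have s: "s \<in> A" and maxA: "\<And>r. r \<in> A \<Longrightarrow> r \<le> s" using Max_in[OF A] Max_ge[OF A(1)] by (auto simp: s_def)
      have "s1 \<le> s" using maxA \<open>s1 \<in> A\<close> .
      define D where "D b = nat \<bar>int (X ?s0) - int b\<bar>" for b
      obtain b where b: "b \<in> K (ch m) \<and> (b, s) \<in> F"
        "\<And>b'. b' \<in> K (ch m) \<and> (b', s) \<in> F \<Longrightarrow> D b \<le> D b'"
        using s ex_has_least_nat[of "\<lambda>b. b \<in> K (ch m) \<and> (b, s) \<in> F" _ D] by (auto simp: A_def)
      have "s < ?s0" using s by (auto simp: A_def)
      have "b' = b \<and> s' = s"
        if F': "(b', s') \<in> F" "s \<le> s'" "s' < ?s0" "min (X ?s0) b \<le> b'" "b' \<le> max (X ?s0) b" for b' s'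
      proof -
        have "X ?s0 \<in> K v" "b \<in> K v" using XK b(1) Kv less.prems by blast+
        then have "b' \<in> K v" using mem_key_span[OF block_v] F'(4,5) by (auto simp: min_def max_def split: if_splits)
        then obtain i where i: "i \<in> {1..k}" "b' \<in> K (ch i)" using key_ch[OF _ ne] by metis
        obtain j' where j': "j' \<in> {1..k}" "s' \<in> J (ch j')" using in_v[OF F'(1) \<open>b' \<in> K v\<close> F'(3)] by blast
        have "j' < j" using earlier[OF j'(2) F'(3) j'(1)] .
        have "j0 \<le> j'" using time_index_mono[OF j0' j'(1) b1(2) j'(2)] \<open>s1 \<le> s\<close> F'(2) by simp
        have "(Q i, j') \<in> ?G" using N[OF \<open>j' < j\<close> j'(1) i(1)] i(2) j'(2) F'(1) by blast
        moreover have "min (Q j) (Q m) \<le> Q i" "Q i \<le> max (Q j) (Q m)"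
          using rank_between[OF less.prems i(1) XK _ i(2) F'(4,5)] b(1) by blast+
        ultimately have "Q i = Q m" using j0(3) \<open>j0 \<le> j'\<close> \<open>j' < j\<close> by blast
        then have "i = m" using quotient_inj i(1) less.prems by blast
        then have "s' \<in> A" using F' i by (auto simp: A_def)
        then have "s' = s" using maxA F'(2) by force
        then have "D b \<le> D b'" using b(2) i(2) F'(1) \<open>i = m\<close> by blast
        then have "b' = b" using F'(4,5) by (auto simp: D_def min_def max_def split: if_splits)
        then show ?thesis using \<open>s' = s\<close> by blast
      qed
      then have "gt b ?s0" unfolding greedy_touched_def using b \<open>s < ?s0\<close> by blast
      then show "\<exists>b\<in>K (ch m). gt b ?s0" using b by blast
    qed
  qed
qed

end

section \<open>Counting the output\<close>

definition inner_nodes :: "btree \<Rightarrow> btree set" where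
  "inner_nodes T = {v \<in> nodes T. children v \<noteq> []}"

definition off_diagonal :: "(nat \<Rightarrow> nat) \<Rightarrow> btree \<Rightarrow> point set" where
  "off_diagonal X v = {(b, t). \<exists>c\<in>set (children v). \<exists>d\<in>set (children v).
     c \<noteq> d \<and> b \<in> key_span X c \<and> t \<in> time_span d}"

lemma finite_inner_nodes [simp]: "finite (inner_nodes T)"
  by (simp add: inner_nodes_def)

text \<open>Descend from the root as long as key and time belong to the same child. Either they
  separate at some node or the descent ends at a single access.\<close>

lemma off_diagonal_cover:
  assumes "block_tree X T" "\<And>v. v \<in> nodes T \<Longrightarrow> children v = [] \<Longrightarrow> start v = stop v"
    and "b \<in> key_span X T" "t \<in> time_span T"
  shows "b = X t \<or> (\<exists>v\<in>inner_nodes T. (b, t) \<in> off_diagonal X v)"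
  using assms
proof (induction T rule: btree.induct)
  case (Node l r cs)
  show ?case
  proof (cases "cs = []")
    case True
    then have "l = r" using Node.prems(2)[of "Node l r cs"] by simp
    then show ?thesis using Node.prems(3,4) by (auto simp: key_span_def time_span_def)
  next
    case False
    obtain c where c: "c \<in> set cs" "b \<in> key_span X c"
      using children_key_cover[OF Node.prems(1)] Node.prems(3) False by auto
    obtain d where d: "d \<in> set cs" "t \<in> time_span d"
      using children_time_cover[OF Node.prems(1)] Node.prems(4) False by auto
    show ?thesis
    proof (cases "c = d")
      case True
      have "b = X t \<or> (\<exists>v\<in>inner_nodes c. (b, t) \<in> off_diagonal X v)"
      proof (rule Node.IH[OF c(1)])
        show "block_tree X c" using block_tree_child[OF Node.prems(1)] c by simp
        show "start v = stop v" if "v \<in> nodes c" "children v = []" for v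
          using Node.prems(2)[of v] that c by auto
      qed (use c d True in auto)
      moreover have "inner_nodes c \<subseteq> inner_nodes (Node l r cs)" using c by (auto simp: inner_nodes_def)
      ultimately show ?thesis by blast
    next
      case False
      have "Node l r cs \<in> inner_nodes (Node l r cs)" using c by (auto simp: inner_nodes_def)
      moreover have "(b, t) \<in> off_diagonal X (Node l r cs)"
        using c d False by (auto simp: off_diagonal_def)
      ultimately show ?thesis by blast
    qed
  qed
qed

text \<open>A node strictly below another one and sharing the time lies in the child that holds this
  time, so its keys belong to that child; off the diagonal of the upper node the key belongs to a
  different child.\<close>

lemma off_diagonal_unique:
  assumes "block_tree X T" "inj X" "v \<in> nodes T" "w \<in> nodes T"
    and "p \<in> off_diagonal X v" "p \<in> off_diagonal X w"
  shows "v = w"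
proof (rule ccontr)
  assume ne: "v \<noteq> w"
  obtain b t where p: "p = (b, t)" by force
  have contra: False
    if vw: "v \<in> nodes T" "w \<in> nodes v" "v \<noteq> w" "p \<in> off_diagonal X v" "p \<in> off_diagonal X w" for v w
  proof -
    obtain c d where cd: "c \<in> set (children v)" "d \<in> set (children v)" "c \<noteq> d"
      "b \<in> key_span X c" "t \<in> time_span d" using vw p by (auto simp: off_diagonal_def)
    have bv: "block_tree X v" using block_tree_node assms(1) vw(1) .
    have bw: "block_tree X w" using block_tree_node bv vw(2) .
    have tw: "t \<in> time_span w" "b \<in> key_span X w"
      using vw(5) p child_time_subset[OF bw] child_key_subset[OF bw] by (auto simp: off_diagonal_def)
    then have "w \<in> nodes d" using node_containing_child[OF bv vw(2) _ _ cd(2,5)] vw(3) by blast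
    then have "b \<in> key_span X d"
      using node_key_subset[OF block_tree_child[OF bv cd(2)]] tw by blast
    then show False using children_key_eqI[OF bv assms(2) cd(1,2,4)] cd(3) by blast
  qed
  have "t \<in> time_span v" "t \<in> time_span w"
    using assms p child_time_subset[OF block_tree_node[OF assms(1,3)]]
      child_time_subset[OF block_tree_node[OF assms(1,4)]] by (auto simp: off_diagonal_def)
  then have "v \<in> nodes w \<or> w \<in> nodes v" using nodes_laminar assms by blast
  then show False using contra[of v w] contra[of w v] ne assms by blast
qed

lemma card_pair_le: "card {x, y} \<le> 2"
  using card_insert_le_m1[of 2 "{y}" x] by simp

lemma finite_greedy: "finite (greedy X n)"
proof (rule finite_subset)
  show "greedy X n \<subseteq> X ` {1..n} \<times> {1..n}"
    using greedy_access_time greedy_times by fastforce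
qed simp

context rgreedy_output
begin

text \<open>
  Points off the diagonal regions come in three kinds: those strictly inside the time interval of their
  row (at most one per time and side), those in regions that Greedy touches on the quotient, and those
  that wing steps of ancestors may add in the last row of a node.
\<close>

definition strictly_inside :: "point set" where
  "strictly_inside = {(b, t) \<in> F. \<exists>v\<in>nodes T. \<exists>c\<in>set (children v). \<exists>d\<in>set (children v).
     c \<noteq> d \<and> b \<in> K c \<and> t \<in> J d \<and> start d < t \<and> t < stop d}"

text \<open>The two rows are nested, and the smaller one excludes both columns. From this one block,
  the nearer column hides the other.\<close>

lemma strictly_inside_unique:
  assumes "(b, t) \<in> strictly_inside" "(b', t) \<in> strictly_inside"
    and "min (X t) b' \<le> b" "b \<le> max (X t) b'"
  shows "b' = b"
proof -
  have node: "\<exists>d\<in>nodes T. b \<notin> K d \<and> start d < t \<and> t < stop d"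
    if inside: "(b, t) \<in> strictly_inside" for b
  proof -
    obtain v c d where *: "v \<in> nodes T" "c \<in> set (children v)" "d \<in> set (children v)" "c \<noteq> d"
      "b \<in> K c" "start d < t" "t < stop d" using inside by (auto simp: strictly_inside_def)
    have "b \<notin> K d" using children_key_eqI[OF bt[OF *(1)] inj_X *(2,3,5)] *(4) by blast
    then show ?thesis using * child_in_nodes by blast
  qed
  obtain d where d: "d \<in> nodes T" "b \<notin> K d" "start d < t" "t < stop d" using node[OF assms(1)] by blast
  obtain d' where d': "d' \<in> nodes T" "b' \<notin> K d'" "start d' < t" "t < stop d'" using node[OF assms(2)] by blast
  have t: "t \<in> J d" "t \<in> J d'" using d d' by (auto simp: time_span_def)
  have F: "(b, t) \<in> F" "(b', t) \<in> F" using assms by (auto simp: strictly_inside_def)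
  obtain w where w: "w \<in> nodes T" "b \<notin> K w" "b' \<notin> K w" "t \<in> J w" "start w < t" "t < stop w"
  proof (cases "d \<in> nodes d'")
    case True
    then show ?thesis using that[of d] d d' t node_key_subset[OF bt[OF d'(1)] True] by blast
  next
    case False
    then have "d' \<in> nodes d" using nodes_laminar[OF tree d(1) d'(1) t] by blast
    then show ?thesis using that[of d'] d d' t node_key_subset[OF bt[OF d(1)]] by blast
  qed
  have "gt b t" "gt b' t" using outside_greedy F w by blast+
  then show ?thesis using one_beyond_per_side[OF w(1,4,5) _ _ w(2) assms(3,4)] by blast
qed

lemma card_strictly_inside: "card strictly_inside \<le> 2 * n"
proof -
  let ?f = "\<lambda>(b, t). (X t < b, t)"
  have "inj_on ?f strictly_inside"
  proof (rule inj_onI)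
    fix p q assume pq: "p \<in> strictly_inside" "q \<in> strictly_inside" "?f p = ?f q"
    obtain b b' t where eq: "p = (b, t)" "q = (b', t)" "X t < b \<longleftrightarrow> X t < b'"
      using pq(3) by (cases p, cases q) auto
    have "min (X t) b' \<le> b \<and> b \<le> max (X t) b' \<or> min (X t) b \<le> b' \<and> b' \<le> max (X t) b"
      using eq(3) by linarith
    then show "p = q" using strictly_inside_unique eq pq by blast
  qed
  then have "card strictly_inside = card (?f ` strictly_inside)" by (simp add: card_image)
  also have "\<dots> \<le> card ((UNIV :: bool set) \<times> {1..n})"
    by (rule card_mono) (use F_bounds in \<open>auto simp: strictly_inside_def\<close>)
  also have "\<dots> = 2 * n" by (simp add: card_cartesian_product)
  finally show ?thesis .
qed

text \<open>Four corners for each region that Greedy touches on the quotient; \<open>inv\<close>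
  turns a rank back into the index of the child with that key interval.\<close>

definition boundary :: "btree \<Rightarrow> point set" where
  "boundary v = (\<Union>(i, j)\<in>greedy (quotient_perm X v) (length (children v)).
     {lo (child v (inv (quotient_perm X v) i)), hi (child v (inv (quotient_perm X v) i))} \<times>
     {start (child v j), stop (child v j)})"

definition final_row :: "btree \<Rightarrow> point set" where
  "final_row v = (\<Union>c\<in>set (children v). {lo c, hi c} \<times> {stop v})"

lemma card_boundary: "card (boundary v) \<le> 4 * card (greedy (quotient_perm X v) (length (children v)))"
proof -
  let ?G = "greedy (quotient_perm X v) (length (children v))"
  have le: "card ({x, y} \<times> {s, t}) \<le> 4" for x y s t :: nat
    unfolding card_cartesian_product using mult_le_mono[OF card_pair_le[of x y] card_pair_le[of s t]] by simp
  have "card (boundary v) \<le> (\<Sum>p\<in>?G. 4)"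
    unfolding boundary_def
    by (rule order_trans[OF card_UN_le[OF finite_greedy] sum_mono]) (use le in auto)
  then show ?thesis by simp
qed

lemma card_final_row: "card (final_row v) \<le> 2 * length (children v)"
proof -
  have le: "card ({x, y} \<times> {t}) \<le> 2" for x y t :: nat
    unfolding card_cartesian_product using card_pair_le[of x y] by simp
  have "card (final_row v) \<le> (\<Sum>c\<in>set (children v). 2)"
    unfolding final_row_def
    by (rule order_trans[OF card_UN_le sum_mono]) (use le in auto)
  also have "\<dots> \<le> 2 * length (children v)" using card_length[of "children v"] by simp
  finally show ?thesis .
qed

lemma off_diagonal_F:
  assumes v: "v \<in> nodes T" and p: "p \<in> F" "p \<in> off_diagonal X v"
  shows "p \<in> strictly_inside \<union> boundary v \<union> final_row v"
proof -
  obtain b t c d where *: "p = (b, t)" "c \<in> set (children v)" "d \<in> set (children v)" "c \<noteq> d"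
    "b \<in> K c" "t \<in> J d" using p(2) by (auto simp: off_diagonal_def)
  have bF: "(b, t) \<in> F" using p * by simp
  have b: "b = lo c \<or> b = hi c" using nonblock_region_columns[OF v *(2,3,4) bF *(5,6)] .
  have "start d < t \<and> t < stop d \<or> t \<in> {start d, stop d}"
    using *(6) unfolding time_span_def by force
  then consider "start d < t \<and> t < stop d" | "t = stop v" | "t \<in> {start d, stop d}" "t \<noteq> stop v"
    by blast
  then show ?thesis
  proof cases
    case 1
    then have "p \<in> strictly_inside"
      using v * bF unfolding strictly_inside_def by blast
    then show ?thesis by blast
  next
    case 2
    then show ?thesis using * b by (auto simp: final_row_def)
  next
    case 3
    interpret block_node X v using block_node[OF v] .
    obtain m j where mj: "m \<in> {1..k}" "c = ch m" "j \<in> {1..k}" "d = ch j"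
      using child_ex *(2,3) by metis
    have "\<exists>b'\<in>K (ch m). gt b' (start (ch j))"
      using region_touched_at_start[OF v *(2,3) bF *(5,6) 3(2)] mj by simp
    then have "(Q m, j) \<in> greedy Q k" using greedy_quotient[OF v mj(3,1)] by simp
    moreover have "inv Q (Q m) = m" using permutes_inverses(2)[OF quotient_permutes] .
    ultimately have "p \<in> boundary v"
      unfolding boundary_def using *(1) b 3(1) mj by (intro UN_I[of "(Q m, j)"]) auto
    then show ?thesis by blast
  qed
qed

text \<open>The \<open>3 * n\<close> consists of \<open>n\<close> accesses and \<open>2 * n\<close>
  points strictly inside rows.\<close>

lemma card_F:
  assumes "\<And>v. v \<in> nodes T \<Longrightarrow> children v = [] \<Longrightarrow> start v = stop v"
  shows "card F \<le> 3 * n + (\<Sum>v\<in>inner_nodes T.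
    4 * card (greedy (quotient_perm X v) (length (children v))) + 2 * length (children v))"
proof -
  let ?A = "(\<lambda>t. (X t, t)) ` {1..n}"
  let ?B = "\<Union>v\<in>inner_nodes T. boundary v \<union> final_row v"
  have "F \<subseteq> ?A \<union> strictly_inside \<union> ?B"
  proof
    fix p assume p: "p \<in> F"
    obtain b t where bt: "p = (b, t)" by force
    have "b \<in> K T" "t \<in> J T" using p F_bounds bt K_T span_T by auto
    then consider "b = X t" | v where "v \<in> inner_nodes T" "p \<in> off_diagonal X v"
      using off_diagonal_cover[OF tree assms] bt by blast
    then show "p \<in> ?A \<union> strictly_inside \<union> ?B"
    proof cases
      case 1
      then show ?thesis using bt p F_bounds by auto
    next
      case 2
      then show ?thesis using off_diagonal_F[OF _ p] by (auto simp: inner_nodes_def)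
    qed
  qed
  moreover have fin: "finite (boundary v \<union> final_row v)" for v
    by (auto simp: boundary_def final_row_def finite_greedy)
  moreover have "finite strictly_inside"
    using finite_F by (rule finite_subset[rotated]) (auto simp: strictly_inside_def)
  ultimately have "card F \<le> card (?A \<union> strictly_inside \<union> ?B)"
    by (intro card_mono) auto
  also have "\<dots> \<le> card ?A + card strictly_inside + card ?B"
    by (meson add_le_mono card_Un_le order_refl order_trans)
  also have "\<dots> \<le> n + 2 * n + card ?B"
    using card_strictly_inside card_image_le[of "{1..n}" "\<lambda>t. (X t, t)"] by simp
  also have "card ?B \<le> (\<Sum>v\<in>inner_nodes T. card (boundary v \<union> final_row v))"
    by (rule card_UN_le) simp
  also have "\<dots> \<le> (\<Sum>v\<in>inner_nodes T.
      4 * card (greedy (quotient_perm X v) (length (children v))) + 2 * length (children v))"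
    by (intro sum_mono order_trans[OF card_Un_le] add_mono card_boundary card_final_row)
  finally show ?thesis by simp
qed

end

section \<open>The lower bound\<close>

lemma OPT_le_card: "feasible n X S \<Longrightarrow> OPT n X \<le> card S"
  unfolding OPT_def by (rule Least_le) blast

text \<open>The value of \<open>LEAST\<close> is attained once some feasible set is known; the
  output of RGreedy will serve as this set.\<close>

lemma OPT_attained:
  assumes "feasible n X S"
  obtains Y where "feasible n X Y" "card Y = OPT n X"
proof -
  have "\<exists>Y. feasible n X Y \<and> card Y = OPT n X"
    unfolding OPT_def by (rule LeastI_ex) (use assms in blast)
  then show ?thesis using that by blast
qed

lemma le_OPT:
  assumes "feasible n X S"
  shows "n \<le> OPT n X"
proof -
  obtain Y where Y: "feasible n X Y" "card Y = OPT n X" using OPT_attained[OF assms] .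
  have "card ((\<lambda>t. (X t, t)) ` {1..n}) = n" by (subst card_image) (auto simp: inj_on_def)
  moreover have "(\<lambda>t. (X t, t)) ` {1..n} \<subseteq> Y" "finite Y"
    using Y(1) by (auto simp: feasible_def accesses_def)
  ultimately show ?thesis using card_mono Y(2) by metis
qed

section \<open>Contracting a solution to the quotient\<close>

context block_node
begin

definition contraction :: "point set \<Rightarrow> point set" where
  "contraction Y = {(Q m, j) | m j. m \<in> {1..k} \<and> j \<in> {1..k} \<and>
     Y \<inter> (key_span X (ch m) \<times> time_span (ch j)) \<noteq> {}}"

text \<open>Choose points of the two regions at minimal L1 distance. A third point in their
  rectangle would be nearer if it lay in either region, so it lies in another one, whose contraction
  is the third point required.\<close>

lemma satisfied_contraction:
  assumes "satisfied Y" "children v \<noteq> []"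
  shows "satisfied (contraction Y)"
  unfolding satisfied_def
proof (intro ballI impI)
  fix p' q' assume pq': "p' \<in> contraction Y" "q' \<in> contraction Y" "fst p' \<noteq> fst q' \<and> snd p' \<noteq> snd q'"
  define R where "R m j = Y \<inter> (key_span X (ch m) \<times> time_span (ch j))" for m j
  obtain m j where p': "p' = (Q m, j)" "m \<in> {1..k}" "j \<in> {1..k}" "R m j \<noteq> {}"
    using pq'(1) by (auto simp: contraction_def R_def)
  obtain m' j' where q': "q' = (Q m', j')" "m' \<in> {1..k}" "j' \<in> {1..k}" "R m' j' \<noteq> {}"
    using pq'(2) by (auto simp: contraction_def R_def)
  define D where "D = (\<lambda>(p :: point, q :: point).
    nat (\<bar>int (fst p) - int (fst q)\<bar> + \<bar>int (snd p) - int (snd q)\<bar>))"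
  obtain p0 q0 where "p0 \<in> R m j" "q0 \<in> R m' j'" using p' q' by blast
  then obtain p q where pq: "p \<in> R m j" "q \<in> R m' j'"
    and least: "\<And>x y. x \<in> R m j \<Longrightarrow> y \<in> R m' j' \<Longrightarrow> D (p, q) \<le> D (x, y)"
    using ex_has_least_nat[of "\<lambda>z. fst z \<in> R m j \<and> snd z \<in> R m' j'" "(p0, q0)" D] by auto
  have Y: "p \<in> Y" "q \<in> Y" using pq by (auto simp: R_def)
  have p: "fst p \<in> key_span X (ch m)" "snd p \<in> time_span (ch j)"
    and q: "fst q \<in> key_span X (ch m')" "snd q \<in> time_span (ch j')" using pq by (auto simp: R_def)
  have ne: "m \<noteq> m'" "j \<noteq> j'" using pq'(3) p' q' by auto
  have "fst p \<noteq> fst q"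
    using children_key_eqI[OF block_v inj child_mem[OF p'(2)] child_mem[OF q'(2)] p(1)] q(1)
      ch_inj[OF p'(2) q'(2)] ne by auto
  moreover have "snd p \<noteq> snd q"
    using children_eqI[OF block_v child_mem[OF p'(3)] child_mem[OF q'(3)] p(2)] q(2)
      ch_inj[OF p'(3) q'(3)] ne by auto
  ultimately obtain r where r: "r \<in> Y" "r \<in> rect p q" "r \<noteq> p" "r \<noteq> q"
    using assms(1) Y unfolding satisfied_def by (metis DiffE IntE insertCI)
  obtain a s where as: "r = (a, s)" by force
  have bet: "min (fst p) (fst q) \<le> a" "a \<le> max (fst p) (fst q)"
    "min (snd p) (snd q) \<le> s" "s \<le> max (snd p) (snd q)"
    using r(2) as by (auto simp: rect_def)
  have "fst p \<in> key_span X v" "fst q \<in> key_span X v"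
    using p q child_key_subset[OF block_v child_mem] p' q' by blast+
  then have "a \<in> key_span X v"
    using bet mem_key_span[OF block_v] by (auto simp: min_def max_def split: if_splits)
  then obtain i where i: "i \<in> {1..k}" "a \<in> key_span X (ch i)" using key_ch[OF _ assms(2)] by metis
  have "snd p \<in> time_span v" "snd q \<in> time_span v"
    using p q child_time_subset[OF block_v child_mem] p' q' by blast+
  then have "s \<in> time_span v"
    using bet unfolding time_span_def by (auto simp: min_def max_def split: if_splits)
  then obtain l where l: "l \<in> {1..k}" "s \<in> time_span (ch l)" using time_ch[OF _ assms(2)] by metis
  have "r \<in> R i l" using r(1) as i l by (auto simp: R_def)
  then have "(Q i, l) \<in> contraction Y" using i l by (auto simp: contraction_def R_def)
  moreover have "(Q i, l) \<in> rect p' q'"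
  proof -
    have "min j j' \<le> l" "l \<le> max j j'"
      using time_index_mono[OF p'(3) l(1) p(2) l(2)] time_index_mono[OF l(1) p'(3) l(2) p(2)]
        time_index_mono[OF q'(3) l(1) q(2) l(2)] time_index_mono[OF l(1) q'(3) l(2) q(2)] bet(3,4)
      by linarith+
    moreover have "min (Q m) (Q m') \<le> Q i" "Q i \<le> max (Q m) (Q m')"
      using rank_between[OF p'(2) q'(2) i(1) p(1) q(1) i(2) bet(1,2)] .
    ultimately show ?thesis unfolding p'(1) q'(1) mem_rect by blast
  qed
  moreover have "D (r, q) < D (p, q)" "D (p, r) < D (p, q)"
    using bet r(3,4) as by (auto simp: D_def prod_eq_iff min_def max_def split: if_splits)
  then have "r \<notin> R m j" "r \<notin> R m' j'" using least pq by (meson leD)+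
  then have "(Q i, l) \<noteq> p'" "(Q i, l) \<noteq> q'"
    using \<open>r \<in> R i l\<close> quotient_inj i(1) p' q' by auto
  ultimately show "\<exists>r. r \<in> contraction Y \<inter> rect p' q' - {p', q'}" by blast
qed

lemma card_contraction:
  assumes "finite Y"
  shows "finite (contraction Y)" "card (contraction Y) \<le> k + card (Y \<inter> off_diagonal X v)"
proof -
  \<comment> \<open>\<open>g\<close> sends a point to the contracted position of its region. The
    choices are unique because children are disjoint, so each occupied off-diagonal region is the
    image of one of its points.\<close>
  define g where "g p = (Q (SOME m. m \<in> {1..k} \<and> fst p \<in> key_span X (ch m)),
    SOME j. j \<in> {1..k} \<and> snd p \<in> time_span (ch j))" for p :: point
  have sub: "contraction Y \<subseteq> (\<lambda>j. (Q j, j)) ` {1..k} \<union> g ` (Y \<inter> off_diagonal X v)"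
  proof
    fix z assume "z \<in> contraction Y"
    then obtain m j where mj: "z = (Q m, j)" "m \<in> {1..k}" "j \<in> {1..k}"
      "Y \<inter> (key_span X (ch m) \<times> time_span (ch j)) \<noteq> {}" unfolding contraction_def by blast
    then obtain p where p: "p \<in> Y" "fst p \<in> key_span X (ch m)" "snd p \<in> time_span (ch j)"
      using mem_Times_iff by blast
    note z = mj(1-3) p
    show "z \<in> (\<lambda>j. (Q j, j)) ` {1..k} \<union> g ` (Y \<inter> off_diagonal X v)"
    proof (cases "m = j")
      case False
      then have "ch m \<noteq> ch j" using ch_inj z by blast
      then have "p \<in> off_diagonal X v"
        using z child_mem[OF z(2)] child_mem[OF z(3)] unfolding off_diagonal_def by (cases p) auto
      moreover have "(SOME m. m \<in> {1..k} \<and> fst p \<in> key_span X (ch m)) = m"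
        using z children_key_eqI[OF block_v inj child_mem child_mem] ch_inj by (intro some_equality) blast+
      moreover have "(SOME j. j \<in> {1..k} \<and> snd p \<in> time_span (ch j)) = j"
        using z children_eqI[OF block_v child_mem child_mem] ch_inj by (intro some_equality) blast+
      ultimately have "z = g p" "p \<in> Y \<inter> off_diagonal X v" using z by (auto simp: g_def)
      then show ?thesis by blast
    qed (use z in blast)
  qed
  have fin: "finite (Y \<inter> off_diagonal X v)" using assms by simp
  show "finite (contraction Y)" using sub fin finite_subset by fastforce
  have "card (contraction Y) \<le> card ((\<lambda>j. (Q j, j)) ` {1..k} \<union> g ` (Y \<inter> off_diagonal X v))"
    using sub fin by (intro card_mono) auto
  also have "\<dots> \<le> card ((\<lambda>j. (Q j, j)) ` {1..k}) + card (g ` (Y \<inter> off_diagonal X v))"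
    by (rule card_Un_le)
  also have "\<dots> \<le> k + card (Y \<inter> off_diagonal X v)"
    using card_image_le[of "{1..k}" "\<lambda>j. (Q j, j)"] card_image_le[OF fin, of g] by simp
  finally show "card (contraction Y) \<le> k + card (Y \<inter> off_diagonal X v)" .
qed

lemma OPT_quotient_le:
  assumes "finite Y" "satisfied Y" "children v \<noteq> []" "\<And>t. t \<in> time_span v \<Longrightarrow> (X t, t) \<in> Y"
  shows "OPT k Q \<le> k + card (Y \<inter> off_diagonal X v)"
proof -
  have "(Q j, j) \<in> contraction Y" if j: "j \<in> {1..k}" for j
  proof -
    let ?s = "start (ch j)"
    have s: "?s \<in> time_span (ch j)" using block_ch[OF j] by simp
    then have "(X ?s, ?s) \<in> Y" using assms(4) child_time_subset[OF block_v child_mem[OF j]] by blast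
    then show ?thesis using s X_in_key_span[OF s, of X] j by (auto simp: contraction_def)
  qed
  then have "feasible k Q (contraction Y)"
    unfolding feasible_def accesses_def
    using card_contraction(1)[OF assms(1)] satisfied_contraction[OF assms(2,3)] by blast
  then show ?thesis using OPT_le_card card_contraction(2)[OF assms(1)] order_trans by blast
qed

end

lemma sum_OPT_quotients_le:
  assumes "block_tree X T" "inj X" "finite Y" "satisfied Y" "\<And>t. t \<in> time_span T \<Longrightarrow> (X t, t) \<in> Y"
  shows "(\<Sum>v\<in>inner_nodes T. OPT (length (children v)) (quotient_perm X v)) \<le>
    (\<Sum>v\<in>inner_nodes T. length (children v)) + card Y"
proof -
  have le: "OPT (length (children v)) (quotient_perm X v) \<le>
      length (children v) + card (Y \<inter> off_diagonal X v)" if v: "v \<in> inner_nodes T" for v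
  proof -
    interpret block_node X v
      using v assms block_tree_node by unfold_locales (auto simp: inner_nodes_def)
    show ?thesis
      using OPT_quotient_le[OF assms(3,4)] assms(5) v node_time_subset[OF assms(1)]
      by (auto simp: inner_nodes_def)
  qed
  have "(\<Sum>v\<in>inner_nodes T. card (Y \<inter> off_diagonal X v)) =
      card (\<Union>v\<in>inner_nodes T. Y \<inter> off_diagonal X v)"
  proof (rule card_UN_disjoint[symmetric])
    show "\<forall>v\<in>inner_nodes T. \<forall>w\<in>inner_nodes T. v \<noteq> w \<longrightarrow>
        Y \<inter> off_diagonal X v \<inter> (Y \<inter> off_diagonal X w) = {}"
      using off_diagonal_unique[OF assms(1,2)] by (auto simp: inner_nodes_def)
  qed (use assms in auto)
  also have "\<dots> \<le> card Y" by (rule card_mono) (use assms in auto)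
  finally have "(\<Sum>v\<in>inner_nodes T. card (Y \<inter> off_diagonal X v)) \<le> card Y" .
  moreover have "(\<Sum>v\<in>inner_nodes T. OPT (length (children v)) (quotient_perm X v)) \<le>
      (\<Sum>v\<in>inner_nodes T. length (children v) + card (Y \<inter> off_diagonal X v))"
    using le by (rule sum_mono)
  ultimately show ?thesis by (simp add: sum.distrib)
qed

section \<open>Total number of children in the tree\<close>

lemma distinct_children: "block_tree X v \<Longrightarrow> distinct (children v)"
  unfolding distinct_conv_nth
proof (intro allI impI)
  fix i j assume v: "block_tree X v" and ij: "i < length (children v)" "j < length (children v)" "i \<noteq> j"
  have "start (children v ! i) \<le> stop (children v ! i)"
    using block_tree_start_le_stop[OF block_tree_nth_child[OF v ij(1)]] .
  then show "children v ! i \<noteq> children v ! j"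
    using children_before[OF v, of i j] children_before[OF v, of j i] ij by (cases "i < j") auto
qed

lemma sum_UN_le_nat:
  fixes f :: "'a \<Rightarrow> nat"
  assumes "finite I" "\<And>i. i \<in> I \<Longrightarrow> finite (A i)"
  shows "sum f (\<Union>i\<in>I. A i) \<le> (\<Sum>i\<in>I. sum f (A i))"
  using assms
proof (induction I rule: finite_induct)
  case (insert i I)
  have "sum f (A i \<union> (\<Union>i\<in>I. A i)) \<le> sum f (A i) + sum f (\<Union>i\<in>I. A i)"
    using sum_Un_nat[of "A i" "\<Union>i\<in>I. A i" f] insert by auto
  then show ?case using insert by simp
qed simp

text \<open>The \<open>+ 2\<close> strengthens the induction: each of the \<open>k\<close> children
  returns 2, which pays for the \<open>k\<close> children of the node itself and leaves
  \<open>k \<ge> 2\<close>.\<close>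

lemma sum_children_le:
  assumes "block_tree X T"
  shows "(\<Sum>v\<in>inner_nodes T. length (children v)) + 2 \<le> 2 * card (time_span T)"
  using assms
proof (induction T rule: btree.induct)
  case (Node a b cs)
  let ?T = "Node a b cs"
  let ?h = "\<lambda>c. \<Sum>v\<in>inner_nodes c. length (children v)"
  show ?case
  proof (cases "cs = []")
    case True
    then have "inner_nodes ?T = {}" by (auto simp: inner_nodes_def)
    moreover have "card (time_span ?T) \<ge> 1"
      using block_tree_start_le_stop[OF Node.prems] by (simp add: time_span_def)
    ultimately show ?thesis by simp
  next
    case False
    have bc: "block_tree X c" if "c \<in> set cs" for c using block_tree_child[OF Node.prems] that by simp
    have "inner_nodes ?T = {?T} \<union> (\<Union>c\<in>set cs. inner_nodes c)"
      using False by (auto simp: inner_nodes_def)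
    then have "?h ?T \<le> length cs + (\<Sum>v\<in>(\<Union>c\<in>set cs. inner_nodes c). length (children v))"
      using sum_Un_nat[of "{?T}" "\<Union>c\<in>set cs. inner_nodes c" "\<lambda>v. length (children v)"] by simp
    also have "\<dots> \<le> length cs + (\<Sum>c\<in>set cs. ?h c)"
      using sum_UN_le_nat[of "set cs" inner_nodes "\<lambda>v. length (children v)"] by simp
    finally have h: "?h ?T \<le> length cs + (\<Sum>c\<in>set cs. ?h c)" .
    have "(\<Sum>c\<in>set cs. ?h c + 2) \<le> (\<Sum>c\<in>set cs. 2 * card (time_span c))"
      using Node.IH bc by (intro sum_mono) blast
    also have "\<dots> = 2 * card (\<Union>c\<in>set cs. time_span c)"
    proof -
      have "card (\<Union>c\<in>set cs. time_span c) = (\<Sum>c\<in>set cs. card (time_span c))"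
      proof (rule card_UN_disjoint)
        show "\<forall>c\<in>set cs. finite (time_span c)" by (simp add: time_span_def)
        show "\<forall>c\<in>set cs. \<forall>d\<in>set cs. c \<noteq> d \<longrightarrow> time_span c \<inter> time_span d = {}"
          using children_eqI[OF Node.prems] by fastforce
      qed simp
      then show ?thesis by (simp add: sum_distrib_left)
    qed
    also have "(\<Union>c\<in>set cs. time_span c) = time_span ?T"
      using children_time_cover[OF Node.prems] False by simp
    finally have "(\<Sum>c\<in>set cs. ?h c) + 2 * length cs \<le> 2 * card (time_span ?T)"
      using distinct_card[OF distinct_children[OF Node.prems]] unfolding sum.distrib by simp
    moreover have "2 \<le> length cs" using block_tree_length[OF Node.prems] False by simp
    ultimately show ?thesis using h by linarith
  qed
qed

section \<open>Trees with simple quotients\<close>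

lemma convex_nat_set_interval:
  fixes V :: "nat set"
  assumes "finite V" "V \<noteq> {}" "\<And>x y z. x \<in> V \<Longrightarrow> z \<in> V \<Longrightarrow> x \<le> y \<Longrightarrow> y \<le> z \<Longrightarrow> y \<in> V"
  shows "V = {Min V..Max V}"
proof (intro equalityI subsetI)
  fix y assume "y \<in> {Min V..Max V}"
  then show "y \<in> V" using assms(3)[OF Min_in[OF assms(1,2)] Max_in[OF assms(1,2)]] by simp
qed (simp add: assms(1))

text \<open>
  Split into the least possible number (at least two) of consecutive blocks: a nontrivial interval of
  the quotient could be merged into a single block.
\<close>

lemma exists_simple_block_tree:
  assumes "inj X" "is_block X a b"
  shows "\<exists>T. block_tree X T \<and> start T = a \<and> stop T = b \<and> (\<forall>v\<in>nodes T.
    if children v = [] then start v = stop v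
    else simple_perm (length (children v)) (quotient_perm X v))"
  using assms(2)
proof (induction "b - a" arbitrary: a b rule: less_induct)
  case less
  show ?case
  proof (cases "a = b")
    case True
    then show ?thesis
      using less.prems by (intro exI[of _ "Node a b []"]) (auto intro: block_tree.leaf)
  next
    case False
    then have "a < b" using less.prems by (auto simp: is_block_def)
    \<comment> \<open>\<open>cut j\<close> is the first time of piece \<open>j\<close>, counted from
      0; ending at \<open>Suc b\<close> lets every piece be half-open.\<close>
    define cuts where "cuts k cut \<longleftrightarrow> cut 0 = a \<and> cut k = Suc b \<and>
      (\<forall>j<k. cut j < cut (Suc j) \<and> is_block X (cut j) (cut (Suc j) - 1))" for k and cut :: "nat \<Rightarrow> nat"
    define P where "P k \<longleftrightarrow> 2 \<le> k \<and> (\<exists>cut. cuts k cut)" for k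
    have "is_block X s s" for s
      unfolding is_block_def by (auto intro!: exI[of _ "X s"])
    \<comment> \<open>Single times are blocks, so a partition exists; \<open>a < b\<close> gives it
      at least two pieces.\<close>
    then have "P (Suc (b - a))"
      using \<open>a < b\<close> unfolding P_def cuts_def by (auto intro!: exI[of _ "\<lambda>j. a + j"])
    define k where "k = (LEAST k. P k)"
    have "P k" unfolding k_def using \<open>P (Suc (b - a))\<close> by (rule LeastI)
    then obtain cut where k2: "2 \<le> k" and cut: "cuts k cut" by (auto simp: P_def)
    have minimal: "\<not> P k'" if "k' < k" for k' using not_less_Least that unfolding k_def by blast
    have mono: "cut i < cut j" if "i < j" "j \<le> k" for i j
      using that
    proof (induction j)
      case (Suc j)
      then have "cut j < cut (Suc j)" using cut by (simp add: cuts_def)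
      then show ?case using Suc by (cases "i = j") auto
    qed simp
    have mono': "cut i \<le> cut j" if "i \<le> j" "j \<le> k" for i j
      using mono[of i j] that by (cases "i = j") auto
    have "\<exists>T. block_tree X T \<and> start T = cut j \<and> stop T = cut (Suc j) - 1 \<and> (\<forall>v\<in>nodes T.
      if children v = [] then start v = stop v
      else simple_perm (length (children v)) (quotient_perm X v))" if "j < k" for j
    proof (rule less.hyps)
      show "is_block X (cut j) (cut (Suc j) - 1)" using cut that by (simp add: cuts_def)
      have "a \<le> cut j" "cut (Suc j) \<le> Suc b"
        using mono'[of 0 j] mono'[of "Suc j" k] cut that by (auto simp: cuts_def)
      moreover have "a < cut j \<or> cut (Suc j) < Suc b"
        using mono[of 0 j] mono[of "Suc j" k] cut that k2 by (cases "j = 0") (auto simp: cuts_def)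
      ultimately show "cut (Suc j) - 1 - cut j < b - a" using \<open>a < b\<close> by linarith
    qed
    then obtain f where f: "\<And>j. j < k \<Longrightarrow> block_tree X (f j) \<and> start (f j) = cut j \<and>
        stop (f j) = cut (Suc j) - 1 \<and> (\<forall>v\<in>nodes (f j).
        if children v = [] then start v = stop v
        else simple_perm (length (children v)) (quotient_perm X v))"
      by metis
    define T where "T = Node a b (map f [0..<k])"
    have len: "length (children T) = k" by (simp add: T_def)
    have bT: "block_tree X T"
      unfolding T_def
    proof (rule block_tree.inner)
      show "is_block X a b" using less.prems .
      show "start (hd (map f [0..<k])) = a" using f[of 0] k2 cut by (simp add: hd_map cuts_def)
      show "stop (last (map f [0..<k])) = b"
        using f[of "k - 1"] k2 cut by (simp add: last_map cuts_def)
      show "\<forall>i. Suc i < length (map f [0..<k]) \<longrightarrow>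
          start (map f [0..<k] ! Suc i) = Suc (stop (map f [0..<k] ! i))"
      proof (intro allI impI)
        fix i assume i: "Suc i < length (map f [0..<k])"
        then have "cut i < cut (Suc i)" using mono by simp
        then show "start (map f [0..<k] ! Suc i) = Suc (stop (map f [0..<k] ! i))"
          using f[of i] f[of "Suc i"] i by simp
      qed
    qed (use k2 f in auto)
    interpret block_node X T using bT assms(1) by unfold_locales
    have kk: "length (children T) = k" by (rule len)
    have ch: "ch m = f (m - 1)" "time_span (ch m) = {cut (m - 1)..<cut m}" if "m \<in> {1..k}" for m
    proof -
      have "m - 1 < k" using that by auto
      then show *: "ch m = f (m - 1)" by (simp add: child_def T_def)
      have "cut (m - 1) < cut m" using mono[of "m - 1" m] that by simp
      then show "time_span (ch m) = {cut (m - 1)..<cut m}"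
        unfolding * time_span_def using f[of "m - 1"] that by auto
    qed
    have ne: "children T \<noteq> []" using k2 by (simp add: T_def)
    have "simple_perm k Q"
      unfolding simple_perm_def
    proof (intro conjI notI)
      show "Q permutes {1..k}" using quotient_permutes by (simp add: len)
      assume "\<exists>l r. 1 \<le> l \<and> l \<le> r \<and> r \<le> k \<and> 1 < r - l + 1 \<and> r - l + 1 < k \<and> (\<exists>c d. Q ` {l..r} = {c..d})"
      then obtain l r c d where lr: "1 \<le> l" "l < r" "r \<le> k" "r - l + 1 < k" "Q ` {l..r} = {c..d}"
        by auto
      \<comment> \<open>The times covered by the pieces \<open>l\<close> to \<open>r\<close>, now
        numbered from 1. Since their ranks form an interval, so do their keys.\<close>
      let ?U = "{cut (l - 1)..<cut r}"
      have U: "t \<in> ?U \<longleftrightarrow> m \<in> {l..r}" if "m \<in> {1..k}" "t \<in> time_span (ch m)" for t m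
      proof -
        have t: "cut (m - 1) \<le> t" "t < cut m" using that ch by auto
        show ?thesis
        proof
          assume "t \<in> ?U"
          then have "\<not> cut m \<le> cut (l - 1)" "\<not> cut r \<le> cut (m - 1)" using t by auto
          then show "m \<in> {l..r}" using mono'[of m "l - 1"] mono'[of r "m - 1"] lr that by force
        next
          assume "m \<in> {l..r}"
          then have "cut (l - 1) \<le> cut (m - 1)" "cut m \<le> cut r"
            using mono'[of "l - 1" "m - 1"] mono'[of m r] lr by auto
          then show "t \<in> ?U" using t by auto
        qed
      qed
      have UT: "?U \<subseteq> time_span T"
      proof -
        have "a \<le> cut (l - 1)" "cut r \<le> Suc b"
          using mono'[of 0 "l - 1"] mono'[of r k] lr cut by (simp_all add: cuts_def)
        then show ?thesis by (auto simp: T_def time_span_def)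
      qed
      have "X ` ?U = {Min (X ` ?U)..Max (X ` ?U)}"
      proof (rule convex_nat_set_interval)
        show "X ` ?U \<noteq> {}" using mono[of "l - 1" r] lr by auto
        fix x y z assume xyz: "x \<in> X ` ?U" "z \<in> X ` ?U" "x \<le> y" "y \<le> z"
        have piece: "\<exists>m. m \<in> {1..k} \<and> m \<in> {l..r} \<and> x \<in> key_span X (ch m)" if "x \<in> X ` ?U" for x
        proof -
          from that obtain t where t: "t \<in> ?U" "x = X t" by blast
          then obtain m where m: "m \<in> {1..k}" "t \<in> time_span (ch m)"
            using time_ch[OF _ ne] UT kk by (metis subsetD)
          then show ?thesis using U t X_in_key_span by blast
        qed
        obtain m where m: "m \<in> {1..k}" "m \<in> {l..r}" "x \<in> key_span X (ch m)" using piece xyz(1) by blast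
        obtain m' where m': "m' \<in> {1..k}" "m' \<in> {l..r}" "z \<in> key_span X (ch m')" using piece xyz(2) by blast
        have "x \<in> key_span X T" "z \<in> key_span X T" using xyz(1,2) UT by (auto simp: key_span_def)
        then have "y \<in> key_span X T" using mem_key_span[OF bT] xyz(3,4) by auto
        then obtain i where i: "i \<in> {1..k}" "y \<in> key_span X (ch i)" using key_ch[OF _ ne] kk by metis
        have "Q m \<le> Q i" "Q i \<le> Q m'"
          using key_rank_mono[unfolded kk] m m' i xyz(3,4) by blast+
        moreover have "Q m \<in> {c..d}" "Q m' \<in> {c..d}" using lr(5) m m' by blast+
        ultimately have "Q i \<in> Q ` {l..r}" using lr(5) by auto
        then obtain i' where i': "i' \<in> {l..r}" "Q i = Q i'" by blast
        then have "i' \<in> {1..k}" using lr(1,3) by simp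
        then have "i = i'" using quotient_inj[unfolded kk, OF i(1)] i'(2) by blast
        then show "y \<in> X ` ?U" using i i' U[OF i(1)] by (auto simp: key_span_def)
      qed simp
      then have block: "is_block X (cut (l - 1)) (cut r - 1)"
      proof -
        have "cut (l - 1) < cut r" using mono[of "l - 1" r] lr by simp
        moreover from this have "{cut (l - 1)..cut r - 1} = ?U" by auto
        ultimately show ?thesis
          using \<open>X ` ?U = {Min (X ` ?U)..Max (X ` ?U)}\<close> unfolding is_block_def by auto
      qed
      \<comment> \<open>This drops the \<open>r - l\<close> cuts inside \<open>?U\<close>. Since
        \<open>r - l + 1 < k\<close>, at least two pieces remain, against the minimality of
        \<open>k\<close>.\<close>
      define cut' where "cut' j = (if j < l then cut j else cut (j + (r - l)))" for j
      have "cuts (k - (r - l)) cut'"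
        unfolding cuts_def
      proof (intro conjI allI impI)
        show "cut' 0 = a" using lr cut by (simp add: cut'_def cuts_def)
        show "cut' (k - (r - l)) = Suc b" using lr cut by (auto simp: cut'_def cuts_def)
        fix j assume j: "j < k - (r - l)"
        consider "Suc j < l" | "Suc j = l" | "l \<le> j" by linarith
        then show "cut' j < cut' (Suc j)" "is_block X (cut' j) (cut' (Suc j) - 1)"
          using j cut block lr mono[of "l - 1" r] by (cases; auto simp: cut'_def cuts_def)+
      qed
      then have "P (k - (r - l))" unfolding P_def using lr by auto
      moreover have "k - (r - l) < k" using lr(2,3) by linarith
      ultimately show False using minimal by blast
    qed
    then have "if children v = [] then start v = stop v
        else simple_perm (length (children v)) (quotient_perm X v)" if "v \<in> nodes T" for v
    proof (cases "v = T")
      case False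
      then obtain c where "c \<in> set (children T)" "v \<in> nodes c" using nodes_proper_cases \<open>v \<in> nodes T\<close> by blast
      then show ?thesis using f by (auto simp: T_def)
    qed (use ne len in simp)
    moreover have "start T = a" "stop T = b" by (simp_all add: T_def)
    ultimately show ?thesis using bT by blast
  qed
qed

section \<open>The approximation bound\<close>

theorem mainTheorem10:
  fixes c :: real
  assumes "\<And>l Q. simple_perm l Q \<Longrightarrow> real (card (greedy Q l)) \<le> c * real (OPT l Q)"
  shows "\<exists>C::real. \<forall>n X. 1 \<le> n \<and> X permutes {1..n} \<longrightarrow>
           (\<exists>T. block_decomposition_tree n X T \<and>
                feasible n X (rgreedy X T n) \<and>
                real (card (rgreedy X T n)) \<le> C * real (OPT n X))"
proof (intro exI[of _ "7 + 12 * \<bar>c\<bar>"] allI impI)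
  fix n :: nat and X :: "nat \<Rightarrow> nat"
  assume nX: "1 \<le> n \<and> X permutes {1..n}"
  have inj: "inj X" using nX permutes_inj by blast
  have "is_block X 1 n"
    using nX permutes_image[of X "{1..n}"] unfolding is_block_def by blast
  then obtain T where T: "block_tree X T" "start T = 1" "stop T = n"
    and nodes: "\<forall>v\<in>nodes T. if children v = [] then start v = stop v
      else simple_perm (length (children v)) (quotient_perm X v)"
    using exists_simple_block_tree[OF inj] by blast
  have dec: "block_decomposition_tree n X T" using T by (simp add: block_decomposition_tree_def)
  let ?F = "rgreedy X T n"
  let ?k = "\<lambda>v. length (children v)"
  let ?Q = "quotient_perm X"
  interpret rgreedy_output X n T ?F "before_wing X T n"
    using rgreedy_output_rgreedy nX dec by blast
  obtain Y where Y: "feasible n X Y" "card Y = OPT n X" using OPT_attained[OF feasible_F] .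
  have n_le: "n \<le> OPT n X" using le_OPT[OF feasible_F] .
  have "(\<Sum>v\<in>inner_nodes T. ?k v) + 2 \<le> 2 * n" using sum_children_le[OF tree] span_T by simp
  then have sum_k: "(\<Sum>v\<in>inner_nodes T. ?k v) \<le> 2 * n" by simp
  \<comment> \<open>The factor 3: the children contribute at most \<open>2 * n\<close>, hence twice
    the optimum, and \<open>card Y\<close> is the optimum once more.\<close>
  have sum_OPT: "(\<Sum>v\<in>inner_nodes T. OPT (?k v) (?Q v)) \<le> 3 * OPT n X"
  proof -
    have "(\<Sum>v\<in>inner_nodes T. OPT (?k v) (?Q v)) \<le> (\<Sum>v\<in>inner_nodes T. ?k v) + card Y"
    proof (rule sum_OPT_quotients_le[OF tree inj])
      show "finite Y" "satisfied Y" using Y(1) by (auto simp: feasible_def)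
      show "(X t, t) \<in> Y" if "t \<in> time_span T" for t
        using Y(1) that span_T by (auto simp: feasible_def accesses_def)
    qed
    then show ?thesis using sum_k n_le Y(2) by linarith
  qed
  \<comment> \<open>Passing to \<open>\<bar>c\<bar>\<close> provides a nonnegative factor for
    multiplying the bound on the sum of the optima.\<close>
  have greedy_le: "real (card (greedy (?Q v) (?k v))) \<le> \<bar>c\<bar> * real (OPT (?k v) (?Q v))"
    if "v \<in> inner_nodes T" for v
  proof -
    have "simple_perm (?k v) (?Q v)" using nodes that unfolding inner_nodes_def by fastforce
    then have "real (card (greedy (?Q v) (?k v))) \<le> c * real (OPT (?k v) (?Q v))" by (rule assms)
    also have "\<dots> \<le> \<bar>c\<bar> * real (OPT (?k v) (?Q v))" by (intro mult_right_mono) auto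
    finally show ?thesis .
  qed
  have "card ?F \<le> 3 * n + (\<Sum>v\<in>inner_nodes T. 4 * card (greedy (?Q v) (?k v)) + 2 * ?k v)"
    using nodes by (intro card_F) force
  also have "\<dots> = 3 * n + 4 * (\<Sum>v\<in>inner_nodes T. card (greedy (?Q v) (?k v)))
      + 2 * (\<Sum>v\<in>inner_nodes T. ?k v)"
    by (simp add: sum.distrib sum_distrib_left)
  \<comment> \<open>\<open>3 * n + 2 * (2 * n)\<close> gives the 7; below, four points per Greedy
    point times the factor 3 of \<open>sum_OPT\<close> give the 12.\<close>
  also have "\<dots> \<le> 7 * OPT n X + 4 * (\<Sum>v\<in>inner_nodes T. card (greedy (?Q v) (?k v)))"
    using sum_k n_le by linarith
  finally have "real (card ?F) \<le>
      real (7 * OPT n X + 4 * (\<Sum>v\<in>inner_nodes T. card (greedy (?Q v) (?k v))))"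
    by (rule of_nat_mono)
  also have "\<dots> = 7 * real (OPT n X) + 4 * (\<Sum>v\<in>inner_nodes T. real (card (greedy (?Q v) (?k v))))"
    by simp
  also have "(\<Sum>v\<in>inner_nodes T. real (card (greedy (?Q v) (?k v)))) \<le>
      (\<Sum>v\<in>inner_nodes T. \<bar>c\<bar> * real (OPT (?k v) (?Q v)))"
    using greedy_le by (rule sum_mono)
  also have "\<dots> = \<bar>c\<bar> * real (\<Sum>v\<in>inner_nodes T. OPT (?k v) (?Q v))"
    by (simp add: sum_distrib_left)
  also have "\<dots> \<le> \<bar>c\<bar> * real (3 * OPT n X)"
    using sum_OPT by (intro mult_left_mono of_nat_mono) auto
  finally have "real (card ?F) \<le> (7 + 12 * \<bar>c\<bar>) * real (OPT n X)"
    by (simp add: algebra_simps)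
  then show "\<exists>T. block_decomposition_tree n X T \<and> feasible n X (rgreedy X T n) \<and>
      real (card (rgreedy X T n)) \<le> (7 + 12 * \<bar>c\<bar>) * real (OPT n X)"
    using dec feasible_F by blast
qed

end
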